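(* (i) Let $(a_{n,m}),(b_{n,m}),(c_{n,m}),(d_{n,m})$, $n,m\in\mathbb{Z}_+$, be arrays of complex numbers with $a_{0,m}=0$ and $b_{n,0}=0$ for all $n,m\ge 0$, $a_{n,m}\ne 0$ for $n\ge 1,\ m\ge 0$, and $b_{n,m}\neq 0$ for $n\ge 0,\ m\ge 1$. Then there is a family of invertible matrices $$L_{n,m}(x)=\begin{pmatrix} x+\alpha^{(1)}_{n,m}&\alpha^{(2)}_{n,m}&\alpha^{(3)}_{n,m}\\ \alpha^{(4)}_{n+1,m}&0&0\\ \alpha^{(5)}_{n+1,m}&0&1\end{pmatrix},\qquad M_{n,m}(x)=\begin{pmatrix} x+\beta^{(1)}_{n,m}&\alpha^{(2)}_{n,m}&\alpha^{(3)}_{n,m}\\ \alpha^{(4)}_{n,m+1}&1&0\\ \alpha^{(5)}_{n,m+1}&0&0\end{pmatrix},\qquad n,m\in\mathbb{Z}_+,$$ with complex entries $\alpha^{(i)}_{n,m},\beta^{(1)}_{n,m}$ satisfying $c_{n,m}=-\alpha^{(1)}_{n,m}$, $d_{n,m}=-\beta^{(1)}_{n,m}$, $a_{n,m}=-\alpha^{(4)}_{n,m}\alpha^{(2)}_{n,m}$, $b_{n,m}=-\alpha^{(5)}_{n,m}\alpha^{(3)}_{n,m}$, and with $$L_{n,m+1}(x)M_{n,m}(x)-M_{n+1,m}(x)L_{n,m}(x)=0\qquad (n,m\in\mathbb{Z}_+,\ x\in\mathbb{C}),$$ if and only if the arrays satisfy the nonlinear system of difference equations $$c_{n,m+1}=c_{n,m}+\frac{(a+b)_{n+1,m}-(a+b)_{n,m+1}}{(c-d)_{n,m}},\qquad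 d_{n+1,m}=d_{n,m}+\frac{(a+b)_{n+1,m}-(a+b)_{n,m+1}}{(c-d)_{n,m}}\qquad(n,m\ge 0),$$ $$a_{n,m+1}=a_{n,m}\frac{(c-d)_{n,m}}{(c-d)_{n-1,m}}\quad(n\ge 1,\ m\ge 0),\qquad b_{n+1,m}=b_{n,m}\frac{(c-d)_{n,m}}{(c-d)_{n,m-1}}\quad(n\ge 0,\ m\ge 1).$$ (ii) Let initial data $(c_{n,0})_{n\ge 0}$, $(a_{n,0})_{n\ge 1}$, $(d_{0,m})_{m\ge 0}$, $(b_{0,m})_{m\ge 1}$ be given sequences of complex numbers. The system of difference equations $$c_{n,m+1}=c_{n,m}+\frac{(a+b)_{n+1,m}-(a+b)_{n,m+1}}{(c-d)_{n,m}},\qquad d_{n+1,m}=d_{n,m}+\frac{(a+b)_{n+1,m}-(a+b)_{n,m+1}}{(c-d)_{n,m}}\qquad(n,m\ge 0),$$ $$a_{n,m+1}=a_{n,m}\frac{(c-d)_{n,m}}{(c-d)_{n-1,m}}\quad(n\ge 1,\ m\ge 0),\qquad b_{n+1,m}=b_{n,m}\frac{(c-d)_{n,m}}{(c-d)_{n,m-1}}\quad(n\ge 0,\ m\ge 1),$$ with these initial data and the boundary conditions $a_{0,m}=0=b_{n,0}$ ($n,m\ge 0$), has a solution such that $a_{n,m}\neq 0$ and $b_{n,m}\ne 0$ for all $n,m>0$ if and only if the initial data correspond to a perfect system.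
   Context: $\mathbb{Z}_+=\{0,1,2,\dots\}$. Notation: $(a+b)_{n,m}=a_{n,m}+b_{n,m}$, $(c-d)_{n,m}=c_{n,m}-d_{n,m}$; satisfying the system includes that all denominators $(c-d)_{n,m}$ are nonzero. Let $f_j(z)=\sum_{k\ge 0}s_{j,k}z^{-k-1}$, $j=1,2$, be (formal) Laurent series at infinity with complex coefficients. For $(n_1,n_2)\in\mathbb{Z}_+^2$, a (type II) Hermite-Padé polynomial for $(f_1,f_2)$ is a nonzero polynomial $P_{n_1,n_2}$ with $\deg P_{n_1,n_2}\le n_1+n_2$ such that for $j=1,2$ there is a polynomial $Q^{(j)}$ with $f_j(z)P_{n_1,n_2}(z)-Q^{(j)}(z)=\mathcal{O}(z^{-n_j-1})$ as $z\to\infty$. The index $(n_1,n_2)$ is normal if $P_{n_1,n_2}$ is unique up to a multiplicative constant and every nontrivial solution has full degree $n_1+n_2$. The system $(f_1,f_2)$ is perfect if all indices in $\mathbb{Z}_+^2$ are normal. The initial data correspond to a perfect system if there is a perfect system $(f_1,f_2)$ such that they are the entries of the $J$-fraction representations (with nonzero partial numerators) $$f_1(z)\sim-\cfrac{1}{z-c_{0,0}-\cfrac{a_{1,0}}{z-c_{1,0}-\cfrac{a_{2,0}}{\ddots}}},\qquad f_2(z)\sim-\cfrac{1}{z-d_{0,0}-\cfrac{b_{0,1}}{z-d_{0,1}-\cfrac{b_{0,2}}{\ddots}}},$$ where $\sim$ means equality of formal Laurent series at infinity. *)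

theory Defs
  imports
    "HOL-Analysis.Analysis"
    "HOL-Computational_Algebra.Formal_Laurent_Series"
begin

section \<open>Transition matrices and the difference system\<close>

text \<open>The entries \<open>\<alpha>\<^sup>(\<^sup>i\<^sup>)\<^sub>n\<^sub>,\<^sub>m\<close> are written \<open>\<alpha> i n m\<close>; only \<open>i = 1, \<dots>, 5\<close> is used.\<close>

definition L_mat ::
  "(nat \<Rightarrow> nat \<Rightarrow> nat \<Rightarrow> complex) \<Rightarrow> nat \<Rightarrow> nat \<Rightarrow> complex \<Rightarrow> complex^3^3" where
  "L_mat \<alpha> n m x = vector
    [vector [x + \<alpha> 1 n m, \<alpha> 2 n m, \<alpha> 3 n m],
     vector [\<alpha> 4 (n + 1) m, 0, 0],
     vector [\<alpha> 5 (n + 1) m, 0, 1]]"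

definition M_mat ::
  "(nat \<Rightarrow> nat \<Rightarrow> nat \<Rightarrow> complex) \<Rightarrow> (nat \<Rightarrow> nat \<Rightarrow> complex) \<Rightarrow> nat \<Rightarrow> nat \<Rightarrow> complex \<Rightarrow> complex^3^3"
  where
  "M_mat \<alpha> \<beta> n m x = vector
    [vector [x + \<beta> n m, \<alpha> 2 n m, \<alpha> 3 n m],
     vector [\<alpha> 4 n (m + 1), 1, 0],
     vector [\<alpha> 5 n (m + 1), 0, 0]]"

text \<open>Division by zero is total in HOL, so the nonvanishing of all denominators is stated
  explicitly.\<close>

definition difference_system ::
  "(nat \<Rightarrow> nat \<Rightarrow> complex) \<Rightarrow> (nat \<Rightarrow> nat \<Rightarrow> complex) \<Rightarrow>
   (nat \<Rightarrow> nat \<Rightarrow> complex) \<Rightarrow> (nat \<Rightarrow> nat \<Rightarrow> complex) \<Rightarrow> bool" where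
  "difference_system a b c d \<longleftrightarrow>
    (\<forall>n m. c n m - d n m \<noteq> 0) \<and>
    (\<forall>n m. c n (m + 1) = c n m +
       ((a (n + 1) m + b (n + 1) m) - (a n (m + 1) + b n (m + 1))) / (c n m - d n m)) \<and>
    (\<forall>n m. d (n + 1) m = d n m +
       ((a (n + 1) m + b (n + 1) m) - (a n (m + 1) + b n (m + 1))) / (c n m - d n m)) \<and>
    (\<forall>n m. n \<ge> 1 \<longrightarrow> a n (m + 1) = a n m * ((c n m - d n m) / (c (n - 1) m - d (n - 1) m))) \<and>
    (\<forall>n m. m \<ge> 1 \<longrightarrow> b (n + 1) m = b n m * ((c n m - d n m) / (c n (m - 1) - d n (m - 1))))"

section \<open>Perfect systems\<close>

text \<open>A formal Laurent series at infinity is represented as a Laurent series in \<open>1 / z\<close>: the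
  indeterminate \<^const>\<open>fls_X\<close> stands for \<open>1 / z\<close>, and \<^const>\<open>fls_X_inv\<close> for \<open>z\<close>.\<close>

definition series_at_infinity :: "(nat \<Rightarrow> complex) \<Rightarrow> complex fls" where
  "series_at_infinity s = fls_X * fps_to_fls (Abs_fps s)"

definition poly_at_infinity :: "complex poly \<Rightarrow> complex fls" where
  "poly_at_infinity p = poly (map_poly fls_const p) fls_X_inv"

text \<open>\<open>g = O(z\<^sup>-\<^sup>k)\<close> as \<open>z \<rightarrow> \<infinity>\<close>, for formal series.\<close>

definition big_o_at_infinity :: "complex fls \<Rightarrow> int \<Rightarrow> bool" where
  "big_o_at_infinity g k \<longleftrightarrow> (\<forall>i<k. fls_nth g i = 0)"

definition hermite_pade_poly ::
  "complex fls \<Rightarrow> complex fls \<Rightarrow> nat \<Rightarrow> nat \<Rightarrow> complex poly \<Rightarrow> bool" where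
  "hermite_pade_poly f1 f2 n1 n2 P \<longleftrightarrow>
    P \<noteq> 0 \<and> degree P \<le> n1 + n2 \<and>
    (\<exists>Q. big_o_at_infinity (f1 * poly_at_infinity P - poly_at_infinity Q) (int n1 + 1)) \<and>
    (\<exists>Q. big_o_at_infinity (f2 * poly_at_infinity P - poly_at_infinity Q) (int n2 + 1))"

definition normal_index :: "complex fls \<Rightarrow> complex fls \<Rightarrow> nat \<Rightarrow> nat \<Rightarrow> bool" where
  "normal_index f1 f2 n1 n2 \<longleftrightarrow>
    (\<exists>P. hermite_pade_poly f1 f2 n1 n2 P \<and>
      (\<forall>P'. hermite_pade_poly f1 f2 n1 n2 P' \<longrightarrow> (\<exists>k. P' = smult k P))) \<and>
    (\<forall>P. hermite_pade_poly f1 f2 n1 n2 P \<longrightarrow> degree P = n1 + n2)"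

definition perfect_system :: "complex fls \<Rightarrow> complex fls \<Rightarrow> bool" where
  "perfect_system f1 f2 \<longleftrightarrow> (\<forall>n1 n2. normal_index f1 f2 n1 n2)"

section \<open>J-fractions\<close>

text \<open>\<open>jfraction_tail c a N k\<close> is the finite continued fraction
  \<open>1 / (z - c\<^sub>k - a\<^sub>k\<^sub>+\<^sub>1 / (z - c\<^sub>k\<^sub>+\<^sub>1 - \<dots> - a\<^sub>k\<^sub>+\<^sub>N / (z - c\<^sub>k\<^sub>+\<^sub>N)))\<close>;
  all denominators have leading term \<open>z\<close>, so no division by zero occurs.\<close>

primrec jfraction_tail ::
  "(nat \<Rightarrow> complex) \<Rightarrow> (nat \<Rightarrow> complex) \<Rightarrow> nat \<Rightarrow> nat \<Rightarrow> complex fls" where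
  "jfraction_tail c a 0 k = 1 / (fls_X_inv - fls_const (c k))"
| "jfraction_tail c a (Suc N) k =
    1 / (fls_X_inv - fls_const (c k) - fls_const (a (k + 1)) * jfraction_tail c a N (k + 1))"

text \<open>The value of an infinite J-fraction is the limit of its convergents in the metric that the
  library puts on \<open>fls\<close>, which is the adic one (two series are close if they agree up to
  a high power of \<open>1 / z\<close>). The entry \<open>a 0\<close> plays no role.\<close>

definition has_jfraction :: "complex fls \<Rightarrow> (nat \<Rightarrow> complex) \<Rightarrow> (nat \<Rightarrow> complex) \<Rightarrow> bool" where
  "has_jfraction f c a \<longleftrightarrow>
    (\<forall>n\<ge>1. a n \<noteq> 0) \<and> (\<lambda>N. - jfraction_tail c a N 0) \<longlonglongrightarrow> f"

definition corresponds_to_perfect_system ::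
  "(nat \<Rightarrow> complex) \<Rightarrow> (nat \<Rightarrow> complex) \<Rightarrow> (nat \<Rightarrow> complex) \<Rightarrow> (nat \<Rightarrow> complex) \<Rightarrow> bool" where
  "corresponds_to_perfect_system c0 a0 d0 b0 \<longleftrightarrow>
    (\<exists>s1 s2. perfect_system (series_at_infinity s1) (series_at_infinity s2) \<and>
      has_jfraction (series_at_infinity s1) c0 a0 \<and>
      has_jfraction (series_at_infinity s2) d0 b0)"

end

theory Submission
  imports Defs
begin

text \<open>
  Write \<open>e n m = c n m - d n m\<close>. Both equivalences see the difference system as a compatibility
  condition on \<open>\<nat> \<times> \<nat>\<close>. It is used in the division-free form of
  \<open>difference_system_iff_products\<close>.

  \<^emph>\<open>Matrices.\<close> Entry by entry, the zero curvature equation consists of an identity between two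
  quadratic polynomials in \<open>x\<close>, which gives the equations for \<open>c\<close> and \<open>d\<close>, and of four first-order
  recurrences whose factors are \<open>\<plusminus> e n m\<close>: they carry \<open>\<alpha> 2\<close> and \<open>\<alpha> 4\<close> along the \<open>m\<close>-direction, \<open>\<alpha> 3\<close> and
  \<open>\<alpha> 5\<close> along the \<open>n\<close>-direction. Multiplied in pairs, the recurrences give the equations for \<open>a\<close>
  and \<open>b\<close>. Invertibility makes \<open>\<alpha> 2\<close> nonzero everywhere, hence \<open>e\<close> too. In the other
  direction \<open>\<alpha> 2\<close> and \<open>\<alpha> 3\<close> are taken as products of the factors, and \<open>\<alpha> 4\<close>, \<open>\<alpha> 5\<close> are then forced.

  \<^emph>\<open>Perfect systems.\<close> The Hermite-Pade conditions say that \<open>p\<close> is orthogonal to the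
  powers below \<open>n\<close> for the moment functional of \<open>f1\<close>, and to those below \<open>m\<close> for that of \<open>f2\<close>. A
  system is perfect iff there are monic \<open>P n m\<close> of degree \<open>n + m\<close> with these orthogonalities and
  with both next moments, \<open>x ^ n\<close> against \<open>f1\<close> and \<open>x ^ m\<close> against \<open>f2\<close>, nonzero
  (\<open>perfect_system_iff_multiple_orthogonal\<close>). The link with the difference system is the pair of
  nearest-neighbour recurrences

    \<open>x P n m = P (n+1) m + c n m P n m + a n m P (n-1) m + b n m P n (m-1)\<close>,

    \<open>x P n m = P n (m+1) + d n m P n m + a n m P (n-1) m + b n m P n (m-1)\<close>.

  If the system is perfect, \<open>a\<close> and \<open>b\<close> are quotients of next moments, and uniqueness of the \<open>P n m\<close> yields
  the recurrences. Expanding \<open>x P n (m+1)\<close> in two ways and comparing the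
  coefficients of \<open>P (n+1) m\<close> and \<open>P n m\<close> (\<open>recurrence_defect\<close>) gives the difference system.

  Conversely, let a solution be given. The row \<open>P n 0\<close> is defined by the three-term recurrence of
  the first J-fraction, and the rest by \<open>P n (m+1) = P (n+1) m + e n m P n m\<close>. The same
  comparison of coefficients now shows that the nearest-neighbour recurrences propagate from row to
  row, so the column \<open>P 0 m\<close> satisfies the three-term recurrence of the second J-fraction. The
  polynomials generated by the recurrence of a J-fraction being orthogonal for its moments
  (\<open>jfraction_orthogonality\<close>), the required orthogonality holds on the two axes. It spreads to
  the whole lattice by that defining relation alone: a step away from an axis keeps the
  orthogonality and multiplies the next moment by \<open>\<plusminus> e n m \<noteq> 0\<close>.
\<close>

section \<open>The zero curvature equation\<close>

text \<open>Clearing denominators makes the system symmetric in the two directions. The equations for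
  \<open>c\<close> and \<open>d\<close>, which share their increment, become the equality of the two increments together with
  the value of one of them.\<close>

lemma difference_system_iff_products:
  "difference_system a b c d \<longleftrightarrow> (\<forall>n m. c n m - d n m \<noteq> 0) \<and>
    (\<forall>n m. c n (Suc m) - d (Suc n) m = c n m - d n m \<and>
      (c n (Suc m) - c n m) * (c n m - d n m) = (a (Suc n) m + b (Suc n) m) - (a n (Suc m) + b n (Suc m))) \<and>
    (\<forall>n m. n \<ge> 1 \<longrightarrow> a n (Suc m) * (c (n - 1) m - d (n - 1) m) = a n m * (c n m - d n m)) \<and>
    (\<forall>n m. m \<ge> 1 \<longrightarrow> b (Suc n) m * (c n (m - 1) - d n (m - 1)) = b n m * (c n m - d n m))"
proof (cases "\<forall>n m. c n m - d n m \<noteq> 0")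
  case True
  have solve: "(x = c n m + s / (c n m - d n m) \<and> y = d n m + s / (c n m - d n m)) \<longleftrightarrow>
      (x - y = c n m - d n m \<and> (x - c n m) * (c n m - d n m) = s)" for x y s n m
  proof -
    have "x = c n m + s / (c n m - d n m) \<longleftrightarrow> (x - c n m) * (c n m - d n m) = s"
      using True[rule_format, of n m] eq_divide_eq[of "x - c n m" s "c n m - d n m"]
      by (simp add: eq_diff_eq' algebra_simps)
    moreover have "y = d n m + (x - c n m) \<longleftrightarrow> x - y = c n m - d n m"
      by (auto simp: algebra_simps)
    ultimately show ?thesis by (metis add_diff_cancel_left')
  qed
  have quotient: "x = y * ((c n m - d n m) / (c n' m' - d n' m')) \<longleftrightarrow>
      x * (c n' m' - d n' m') = y * (c n m - d n m)" for x y n m n' m'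
    using True[rule_format, of n' m'] by (simp add: eq_divide_eq)
  show ?thesis
    unfolding difference_system_def quotient Suc_eq_plus1[symmetric] all_conj_distrib[symmetric] conj_assoc[symmetric]
    using solve by blast
qed (auto simp: difference_system_def)

text \<open>Of the nine entries, the four in the lower right corner agree identically, and the remaining five are
  listed here. The variable \<open>x\<close> survives only in the first.\<close>

lemma zero_curvature_iff_entries:
  "L_mat \<alpha> n (m + 1) x ** M_mat \<alpha> \<beta> n m x - M_mat \<alpha> \<beta> (n + 1) m x ** L_mat \<alpha> n m x = 0 \<longleftrightarrow>
    (x + \<alpha> 1 n (m+1)) * (x + \<beta> n m) + \<alpha> 2 n (m+1) * \<alpha> 4 n (m+1) + \<alpha> 3 n (m+1) * \<alpha> 5 n (m+1)
    = (x + \<beta> (n+1) m) * (x + \<alpha> 1 n m) + \<alpha> 2 (n+1) m * \<alpha> 4 (n+1) m + \<alpha> 3 (n+1) m * \<alpha> 5 (n+1) m \<and>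
    \<alpha> 2 n (m+1) = \<alpha> 2 n m * (\<beta> (n+1) m - \<alpha> 1 n (m+1)) \<and>
    \<alpha> 3 (n+1) m = \<alpha> 3 n m * (\<alpha> 1 n (m+1) - \<beta> (n+1) m) \<and>
    \<alpha> 4 (n+1) m = \<alpha> 4 (n+1) (m+1) * (\<beta> n m - \<alpha> 1 n m) \<and>
    \<alpha> 5 n (m+1) = \<alpha> 5 (n+1) (m+1) * (\<alpha> 1 n m - \<beta> n m)"
  unfolding L_mat_def M_mat_def right_minus_eq
  apply (simp add: matrix_matrix_mult_def vec_eq_iff forall_3 sum_3 vector_3)
  apply (intro conj_cong iffI; (elim conjE)?; (intro conjI)?)
  apply simp_all
  apply (algebra | simp add: algebra_simps)+
  done

lemma invertible_L_mat_iff: "invertible (L_mat \<alpha> n m x) \<longleftrightarrow> \<alpha> 2 n m \<noteq> 0 \<and> \<alpha> 4 (n + 1) m \<noteq> 0"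
  by (simp add: L_mat_def invertible_det_nz det_3 vector_3)

lemma invertible_M_mat_iff: "invertible (M_mat \<alpha> \<beta> n m x) \<longleftrightarrow> \<alpha> 3 n m \<noteq> 0 \<and> \<alpha> 5 n (m + 1) \<noteq> 0"
  by (simp add: M_mat_def invertible_det_nz det_3 vector_3)

text \<open>Comparing the coefficients of \<open>x\<close> and \<open>1\<close>; evaluation at \<open>x = 0\<close> and \<open>x = 1\<close> is enough.\<close>

lemma quadratics_eq_iff:
  fixes c d :: complex
  shows "(\<forall>x. (x - c') * (x - d) + s = (x - d') * (x - c) + t) \<longleftrightarrow>
     c' + d = d' + c \<and> c' * d + s = d' * c + t"
proof
  assume *: "\<forall>x. (x - c') * (x - d) + s = (x - d') * (x - c) + t"
  have 0: "c' * d + s = d' * c + t" using *[rule_format, of 0] by simp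
  with *[rule_format, of 1] show "c' + d = d' + c \<and> c' * d + s = d' * c + t"
    by (simp add: algebra_simps)
next
  assume "c' + d = d' + c \<and> c' * d + s = d' * c + t"
  then show "\<forall>x. (x - c') * (x - d) + s = (x - d') * (x - c) + t"
    by algebra
qed

text \<open>The two products \<open>- \<alpha> 4 n m * \<alpha> 2 n m\<close> and \<open>- \<alpha> 5 n m * \<alpha> 3 n m\<close> are all that the arrays see
  of these entries. There is a gauge freedom in splitting \<open>a\<close> and \<open>b\<close> into factors; the
  converse direction below normalises \<open>\<alpha> 2 n 0 = 1\<close> and \<open>\<alpha> 3 0 m = 1\<close>.\<close>

theorem zero_curvature_iff_difference_system:
  assumes bdry: "\<forall>m. a 0 m = 0" "\<forall>n. b n 0 = 0"
    and a_nz: "\<forall>n m. n \<ge> 1 \<longrightarrow> a n m \<noteq> 0" and b_nz: "\<forall>n m. m \<ge> 1 \<longrightarrow> b n m \<noteq> 0"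
  shows "(\<exists>(\<alpha> :: nat \<Rightarrow> nat \<Rightarrow> nat \<Rightarrow> complex) (\<beta> :: nat \<Rightarrow> nat \<Rightarrow> complex).
            (\<forall>n m x. invertible (L_mat \<alpha> n m x) \<and> invertible (M_mat \<alpha> \<beta> n m x)) \<and>
            (\<forall>n m. c n m = - \<alpha> 1 n m \<and> d n m = - \<beta> n m \<and>
                   a n m = - \<alpha> 4 n m * \<alpha> 2 n m \<and> b n m = - \<alpha> 5 n m * \<alpha> 3 n m) \<and>
            (\<forall>n m x. L_mat \<alpha> n (m + 1) x ** M_mat \<alpha> \<beta> n m x
                   - M_mat \<alpha> \<beta> (n + 1) m x ** L_mat \<alpha> n m x = 0))
         \<longleftrightarrow> difference_system a b c d" (is "?lhs \<longleftrightarrow> ?rhs")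
proof
  assume ?lhs
  then show ?rhs
  proof (elim exE conjE)
    fix \<alpha> :: "nat \<Rightarrow> nat \<Rightarrow> nat \<Rightarrow> complex" and \<beta> :: "nat \<Rightarrow> nat \<Rightarrow> complex"
    assume inv: "\<forall>n m x. invertible (L_mat \<alpha> n m x) \<and> invertible (M_mat \<alpha> \<beta> n m x)"
      and entries: "\<forall>n m. c n m = - \<alpha> 1 n m \<and> d n m = - \<beta> n m \<and>
                   a n m = - \<alpha> 4 n m * \<alpha> 2 n m \<and> b n m = - \<alpha> 5 n m * \<alpha> 3 n m"
      and zc: "\<forall>n m x. L_mat \<alpha> n (m + 1) x ** M_mat \<alpha> \<beta> n m x
                   - M_mat \<alpha> \<beta> (n + 1) m x ** L_mat \<alpha> n m x = 0"
    have nz: "\<alpha> 2 n m \<noteq> 0" "\<alpha> 4 (Suc n) m \<noteq> 0" "\<alpha> 3 n m \<noteq> 0" "\<alpha> 5 n (Suc m) \<noteq> 0" for n m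
      using inv by (simp_all add: invertible_L_mat_iff invertible_M_mat_iff)
    have \<alpha>: "\<alpha> 1 n m = - c n m" "\<beta> n m = - d n m"
      and a: "a n m = - \<alpha> 4 n m * \<alpha> 2 n m" and b: "b n m = - \<alpha> 5 n m * \<alpha> 3 n m" for n m
      using entries by simp_all
    note eqs = zc[unfolded zero_curvature_iff_entries, rule_format, unfolded \<alpha> Suc_eq_plus1[symmetric]]
    have "(x - c n (Suc m)) * (x - d n m) + (- (a n (Suc m) + b n (Suc m)))
        = (x - d (Suc n) m) * (x - c n m) + (- (a (Suc n) m + b (Suc n) m))" for x n m
    proof -
      have "(x + - c n (Suc m)) * (x + - d n m) + \<alpha> 2 n (Suc m) * \<alpha> 4 n (Suc m) +
          \<alpha> 3 n (Suc m) * \<alpha> 5 n (Suc m) = (x + - d (Suc n) m) * (x + - c n m) +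
          \<alpha> 2 (Suc n) m * \<alpha> 4 (Suc n) m + \<alpha> 3 (Suc n) m * \<alpha> 5 (Suc n) m"
        using eqs[of x n m] by blast
      then show ?thesis unfolding a b by algebra
    qed
    then have top: "c n (Suc m) + d n m = d (Suc n) m + c n m"
      "c n (Suc m) * d n m + (- (a n (Suc m) + b n (Suc m))) = d (Suc n) m * c n m + (- (a (Suc n) m + b (Suc n) m))" for n m
      using quadratics_eq_iff by blast+
    have diff: "c n (Suc m) - d (Suc n) m = c n m - d n m" for n m
      using top(1)[of n m] by (simp add: algebra_simps)
    have a2: "\<alpha> 2 n (Suc m) = \<alpha> 2 n m * (c n m - d n m)"
      and a3: "\<alpha> 3 (Suc n) m = - \<alpha> 3 n m * (c n m - d n m)"
      and a4: "\<alpha> 4 (Suc n) m = \<alpha> 4 (Suc n) (Suc m) * (c n m - d n m)"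
      and a5: "\<alpha> 5 n (Suc m) = - \<alpha> 5 (Suc n) (Suc m) * (c n m - d n m)" for n m
    proof -
      have "\<alpha> 2 n (Suc m) = \<alpha> 2 n m * (- d (Suc n) m - - c n (Suc m))"
        "\<alpha> 3 (Suc n) m = \<alpha> 3 n m * (- c n (Suc m) - - d (Suc n) m)"
        "\<alpha> 4 (Suc n) m = \<alpha> 4 (Suc n) (Suc m) * (- d n m - - c n m)"
        "\<alpha> 5 n (Suc m) = \<alpha> 5 (Suc n) (Suc m) * (- c n m - - d n m)"
        using eqs[of 0 n m] by blast+
      with diff[of n m] show "\<alpha> 2 n (Suc m) = \<alpha> 2 n m * (c n m - d n m)"
        "\<alpha> 3 (Suc n) m = - \<alpha> 3 n m * (c n m - d n m)"
        "\<alpha> 4 (Suc n) m = \<alpha> 4 (Suc n) (Suc m) * (c n m - d n m)"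
        "\<alpha> 5 n (Suc m) = - \<alpha> 5 (Suc n) (Suc m) * (c n m - d n m)"
        by algebra+
    qed
    have A: "a n (Suc m) * (c (n - 1) m - d (n - 1) m) = a n m * (c n m - d n m)" if n: "n \<ge> 1" for n m
    proof -
      obtain k where "n = Suc k" using n by (cases n) auto
      then show ?thesis unfolding a a2 by (simp add: a4[of k m])
    qed
    have B: "b (Suc n) m * (c n (m - 1) - d n (m - 1)) = b n m * (c n m - d n m)" if m: "m \<ge> 1" for n m
    proof -
      obtain k where "m = Suc k" using m by (cases m) auto
      then show ?thesis unfolding b a3 by (simp add: a5[of n k])
    qed
    have "c n m - d n m \<noteq> 0" for n m
      using a2[of n m] nz(1)[of n "Suc m"] by auto
    moreover have "(c n (Suc m) - c n m) * (c n m - d n m) = (a (Suc n) m + b (Suc n) m) - (a n (Suc m) + b n (Suc m))" for n m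
      using top[of n m] by algebra
    ultimately show ?rhs
      unfolding difference_system_iff_products using diff A B by simp
  qed
next
  assume ?rhs
  define e where "e n m = c n m - d n m" for n m
  have e_nz: "e n m \<noteq> 0"
    and c: "c n (Suc m) - d (Suc n) m = e n m"
      "(c n (Suc m) - c n m) * e n m = (a (Suc n) m + b (Suc n) m) - (a n (Suc m) + b n (Suc m))"
    and A: "n \<ge> 1 \<Longrightarrow> a n (Suc m) * e (n - 1) m = a n m * e n m"
    and B: "m \<ge> 1 \<Longrightarrow> b (Suc n) m * e n (m - 1) = b n m * e n m" for n m
    using \<open>?rhs\<close> by (simp_all add: difference_system_iff_products e_def)
  \<comment> \<open>the solutions of the recurrences for \<open>\<alpha> 2\<close> and \<open>\<alpha> 3\<close> with initial value 1\<close>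
  define u v where "u n m = (\<Prod>k<m. e n k)" and "v n m = (\<Prod>k<n. - e k m)" for n m
  have uv_nz: "u n m \<noteq> 0" "v n m \<noteq> 0" for n m by (simp_all add: u_def v_def e_nz)
  have u: "u n (Suc m) = u n m * e n m" and v: "v (Suc n) m = - v n m * e n m" for n m
    by (simp_all add: u_def v_def)
  define \<alpha> :: "nat \<Rightarrow> nat \<Rightarrow> nat \<Rightarrow> complex" where
    "\<alpha> i = (\<lambda>n m. if i = 1 then - c n m else if i = 2 then u n m else if i = 3 then v n m
        else if i = 4 then - a n m / u n m else - b n m / v n m)" for i
  define \<beta> where "\<beta> n m = - d n m" for n m
  have \<alpha>: "\<alpha> 1 n m = - c n m" "\<alpha> 2 n m = u n m" "\<alpha> 3 n m = v n m" "\<alpha> 4 n m = - a n m / u n m"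
      "\<alpha> 5 n m = - b n m / v n m" for n m
    by (simp_all add: \<alpha>_def)
  have "invertible (L_mat \<alpha> n m x) \<and> invertible (M_mat \<alpha> \<beta> n m x)" for n m x
    unfolding invertible_L_mat_iff invertible_M_mat_iff \<alpha> using a_nz b_nz uv_nz by simp
  moreover have "c n m = - \<alpha> 1 n m \<and> d n m = - \<beta> n m \<and>
      a n m = - \<alpha> 4 n m * \<alpha> 2 n m \<and> b n m = - \<alpha> 5 n m * \<alpha> 3 n m" for n m
    unfolding \<alpha> \<beta>_def using uv_nz[of n m] by simp
  moreover have "L_mat \<alpha> n (m + 1) x ** M_mat \<alpha> \<beta> n m x
                   - M_mat \<alpha> \<beta> (n + 1) m x ** L_mat \<alpha> n m x = 0" for n m x
  proof -
    have ab: "u n m * (- a n m / u n m) = - a n m" "v n m * (- b n m / v n m) = - b n m" for n m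
      using uv_nz[of n m] by simp_all
    have d: "d (Suc n) m = c n (Suc m) - e n m" "d n m = c n m - e n m"
      using c(1)[of n m] by (simp_all add: e_def algebra_simps)
    have "(x + - c n (Suc m)) * (x + - d n m) + - a n (Suc m) + - b n (Suc m) =
        (x + - d (Suc n) m) * (x + - c n m) + - a (Suc n) m + - b (Suc n) m"
      unfolding d using c(2)[of n m] by algebra
    moreover have "u n (Suc m) = u n m * (- d (Suc n) m - - c n (Suc m))"
      "v (Suc n) m = v n m * (- c n (Suc m) - - d (Suc n) m)"
      unfolding u v d by (simp_all add: algebra_simps)
    moreover have "- a (Suc n) m / u (Suc n) m = - a (Suc n) (Suc m) / u (Suc n) (Suc m) * (- d n m - - c n m)"
      unfolding u d using A[of "Suc n" m] uv_nz[of "Suc n" m] e_nz[of "Suc n" m] by (simp add: field_simps)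
    moreover have "- b n (Suc m) / v n (Suc m) = - b (Suc n) (Suc m) / v (Suc n) (Suc m) * (- c n m - - d n m)"
      unfolding v d using B[of "Suc m" n] uv_nz[of n "Suc m"] e_nz[of n "Suc m"] by (simp add: field_simps)
    ultimately show ?thesis
      unfolding zero_curvature_iff_entries unfolding \<alpha> \<beta>_def Suc_eq_plus1[symmetric] ab by blast
  qed
  ultimately show ?lhs by blast
qed

section \<open>Hermite-Pade conditions as vanishing moments\<close>

lemma poly_at_infinity_0 [simp]: "poly_at_infinity 0 = 0"
  by (simp add: poly_at_infinity_def)

lemma poly_at_infinity_pCons:
  "poly_at_infinity (pCons c p) = fls_const c + fls_X_inv * poly_at_infinity p"
  by (cases "pCons c p = 0") (auto simp add: poly_at_infinity_def map_poly_pCons)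

lemma fls_nth_poly_at_infinity:
  "fls_nth (poly_at_infinity p) i = (if i \<le> 0 then coeff p (nat (- i)) else 0)"
proof (induction p arbitrary: i)
  case (pCons c p)
  show ?case
    by (auto simp: poly_at_infinity_pCons pCons.IH fls_X_inv_times_conv_shift coeff_pCons nat_diff_distrib
          split: nat.splits)
qed simp

lemma poly_at_infinity_add: "poly_at_infinity (p + q) = poly_at_infinity p + poly_at_infinity q"
  by (intro fls_eqI) (simp add: fls_nth_poly_at_infinity)

lemma poly_at_infinity_smult: "poly_at_infinity (smult c p) = fls_const c * poly_at_infinity p"
  by (intro fls_eqI) (simp add: fls_nth_poly_at_infinity)

lemma poly_at_infinity_diff: "poly_at_infinity (p - q) = poly_at_infinity p - poly_at_infinity q"
  by (intro fls_eqI) (simp add: fls_nth_poly_at_infinity)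

lemma polynomial_part_exists: "\<exists>q. \<forall>i\<le>0. fls_nth (poly_at_infinity q) i = fls_nth g i"
proof -
  define d where "d = nat (- fls_subdegree g)"
  define q where "q = Abs_poly (\<lambda>k. if k \<le> d then fls_nth g (- int k) else 0)"
  have "coeff q k = (if k \<le> d then fls_nth g (- int k) else 0)" for k
    unfolding q_def by (subst coeff_Abs_poly[of d]) auto
  then have "\<forall>i\<le>0. fls_nth (poly_at_infinity q) i = fls_nth g i"
    by (auto simp: fls_nth_poly_at_infinity d_def)
  then show ?thesis ..
qed

text \<open>For \<open>f = series_at_infinity s\<close> this is the value at \<open>x ^ k * p\<close> of the linear functional with
  moments \<open>s\<close>. Reading it off from \<open>f * p\<close> makes it linear in both arguments and makes
  sense for every \<open>f\<close>.\<close>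

definition moment :: "complex fls \<Rightarrow> nat \<Rightarrow> complex poly \<Rightarrow> complex" where
  "moment f k p = fls_nth (f * poly_at_infinity p) (int k + 1)"

lemma moment_0 [simp]: "moment f k 0 = 0"
  by (simp add: moment_def)

lemma moment_add [simp]: "moment f k (p + q) = moment f k p + moment f k q"
  by (simp add: moment_def poly_at_infinity_add distrib_left)

lemma moment_diff [simp]: "moment f k (p - q) = moment f k p - moment f k q"
  by (simp add: moment_def poly_at_infinity_diff right_diff_distrib)

lemma moment_smult [simp]: "moment f k (smult c p) = c * moment f k p"
proof -
  have "f * (fls_const c * g) = fls_const c * (f * g)" for g by (simp add: ac_simps)
  from this[of "poly_at_infinity p"] show ?thesis
    by (simp only: moment_def poly_at_infinity_smult fls_mult_const_nth)
qed

lemma moment_pCons_0 [simp]: "moment f k (pCons 0 p) = moment f (Suc k) p"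
proof -
  have "f * (fls_X_inv * g) = fls_X_inv * (f * g)" for g by (simp add: ac_simps)
  then show ?thesis
    by (simp add: moment_def poly_at_infinity_pCons fls_X_inv_times_conv_shift(1) add_ac)
qed

definition orthogonal_below :: "complex fls \<Rightarrow> nat \<Rightarrow> complex poly \<Rightarrow> bool" where
  "orthogonal_below f n p \<longleftrightarrow> (\<forall>k<n. moment f k p = 0)"

text \<open>The polynomial \<open>Q\<close> can only be the polynomial part of \<open>f * p\<close>, so the order condition says that
  the coefficients of \<open>1 / z, \<dots>, 1 / z ^ n\<close> in \<open>f * p\<close> vanish.\<close>

lemma ex_big_o_iff_orthogonal_below:
  "(\<exists>Q. big_o_at_infinity (f * poly_at_infinity p - poly_at_infinity Q) (int n + 1)) \<longleftrightarrow>
   orthogonal_below f n p"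
proof
  assume "\<exists>Q. big_o_at_infinity (f * poly_at_infinity p - poly_at_infinity Q) (int n + 1)"
  then obtain Q where Q: "\<And>i. i < int n + 1 \<Longrightarrow>
      fls_nth (f * poly_at_infinity p) i = fls_nth (poly_at_infinity Q) i"
    by (auto simp: big_o_at_infinity_def)
  show "orthogonal_below f n p"
    unfolding orthogonal_below_def moment_def using Q by (simp add: fls_nth_poly_at_infinity)
next
  assume orth: "orthogonal_below f n p"
  obtain Q where Q: "\<forall>i\<le>0. fls_nth (poly_at_infinity Q) i = fls_nth (f * poly_at_infinity p) i"
    using polynomial_part_exists by blast
  have "fls_nth (f * poly_at_infinity p - poly_at_infinity Q) i = 0" if "i < int n + 1" for i
  proof (cases "i \<le> 0")
    case False
    then have "moment f (nat (i - 1)) p = 0"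
      using orth that by (auto simp: orthogonal_below_def)
    with False show ?thesis by (simp add: moment_def fls_nth_poly_at_infinity)
  qed (use Q in simp)
  then show "\<exists>Q. big_o_at_infinity (f * poly_at_infinity p - poly_at_infinity Q) (int n + 1)"
    unfolding big_o_at_infinity_def by blast
qed

lemma hermite_pade_poly_iff:
  "hermite_pade_poly f1 f2 n m p \<longleftrightarrow>
    p \<noteq> 0 \<and> degree p \<le> n + m \<and> orthogonal_below f1 n p \<and> orthogonal_below f2 m p"
  by (simp add: hermite_pade_poly_def ex_big_o_iff_orthogonal_below)

section \<open>Expansion in a J-fraction\<close>

lemma big_o_iff_subdegree: "big_o_at_infinity g k \<longleftrightarrow> g = 0 \<or> k \<le> fls_subdegree g"
  unfolding big_o_at_infinity_def
  by (metis fls_eq0_below_subdegree fls_subdegree_geI fls_zero_nth order_less_le_trans)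

lemma big_o_at_infinity_mult:
  assumes "big_o_at_infinity g k" "big_o_at_infinity h l"
  shows "big_o_at_infinity (g * h) (k + l)" "fls_nth (g * h) (k + l) = fls_nth g k * fls_nth h l"
proof -
  show "big_o_at_infinity (g * h) (k + l)"
    using assms by (cases "g = 0 \<or> h = 0") (auto simp: big_o_iff_subdegree fls_subdegree_mult)
  show "fls_nth (g * h) (k + l) = fls_nth g k * fls_nth h l"
  proof (cases "g = 0 \<or> h = 0")
    case False
    then have le: "k \<le> fls_subdegree g" "l \<le> fls_subdegree h"
      using assms by (auto simp: big_o_iff_subdegree)
    show ?thesis
    proof (cases "k = fls_subdegree g \<and> l = fls_subdegree h")
      case True
      then show ?thesis using fls_times_base[of g h] by simp
    next
      case neq: False
      then have "k < fls_subdegree g \<or> l < fls_subdegree h" using le by auto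
      then have "k + l < fls_subdegree g + fls_subdegree h \<and> fls_nth g k * fls_nth h l = 0"
        using le by auto
      then show ?thesis by (simp add: fls_times_nth_eq0)
    qed
  qed auto
qed

text \<open>Both equations of \<^const>\<open>jfraction_tail\<close> in one form: the innermost level has the tail 0 below it.\<close>

abbreviation jfraction_denominator where
  "jfraction_denominator c a N k \<equiv>
    fls_X_inv - fls_const (c k) -
      (case N of 0 \<Rightarrow> 0 | Suc N' \<Rightarrow> fls_const (a (k + 1)) * jfraction_tail c a N' (k + 1))"

lemma jfraction_tail_eq: "jfraction_tail c a N k = 1 / jfraction_denominator c a N k"
  by (cases N) simp_all

text \<open>A series of the form \<open>z + O(1)\<close> has an inverse of the form \<open>1 / z + O(1 / z ^ 2)\<close>.\<close>

lemma inverse_of_linear_leading: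
  fixes D :: "complex fls"
  assumes "\<forall>i < -1. fls_nth D i = 0" "fls_nth D (-1) = 1"
  shows "D \<noteq> 0" "big_o_at_infinity (1 / D) 1" "fls_nth (1 / D) 1 = 1"
proof -
  show nz: "D \<noteq> 0" using assms(2) by auto
  have sd: "fls_subdegree D = -1"
    by (rule fls_subdegree_eqI) (use assms in auto)
  show "big_o_at_infinity (1 / D) 1"
    using fls_divide_nth_below[of _ 1 D] by (simp add: big_o_at_infinity_def sd)
  show "fls_nth (1 / D) 1 = 1"
    using fls_divide_nth_base[of 1 D] by (simp add: sd assms)
qed

lemma jfraction_tail_leading:
  "big_o_at_infinity (jfraction_tail c a N k) 1 \<and> fls_nth (jfraction_tail c a N k) 1 = 1 \<and>
   jfraction_denominator c a N k \<noteq> 0"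
proof (induction N arbitrary: k)
  case 0
  show ?case
    using inverse_of_linear_leading[of "jfraction_denominator c a 0 k"] by (simp add: fls_const_nth)
next
  case (Suc N)
  have "\<forall>i<1. fls_nth (jfraction_tail c a N (k + 1)) i = 0"
    using Suc.IH[of "k + 1"] by (simp add: big_o_at_infinity_def)
  then show ?case
    using inverse_of_linear_leading[of "jfraction_denominator c a (Suc N) k"] by (simp add: fls_const_nth)
qed

lemma jfraction_tail_times_denominator:
  "jfraction_tail c a N k * jfraction_denominator c a N k = 1"
  using jfraction_tail_leading[of c a N k] unfolding jfraction_tail_eq[of c a N k] by simp

text \<open>The difference of two reciprocals carries the product of the reciprocals as a factor, and each is
  \<open>O(1 / z)\<close>. So every level of the fraction improves the agreement of consecutive convergents; the
  rate stated here is weaker than what this gives, and sufficient for convergence.\<close>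

lemma jfraction_tail_Suc_close:
  "big_o_at_infinity (jfraction_tail c a N k - jfraction_tail c a (Suc N) k) (int N + 2)"
proof (induction N arbitrary: k)
  case 0
  have "fls_nth (jfraction_tail c a N k) i = (if i = 1 then 1 else 0)" if "i < 2" for N i
    using jfraction_tail_leading[of c a N k] that
    by (cases "i = 1") (auto simp: big_o_at_infinity_def)
  then show ?case unfolding big_o_at_infinity_def by (simp del: jfraction_tail.simps)
next
  case (Suc N)
  let ?t = "\<lambda>N k. jfraction_tail c a N k"
  have eq: "?t (Suc N) k - ?t (Suc (Suc N)) k =
      fls_const (a (k + 1)) * (?t (Suc N) k * (?t (Suc (Suc N)) k * (?t N (k + 1) - ?t (Suc N) (k + 1))))"
    using jfraction_tail_times_denominator[of c a "Suc N" k]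
      jfraction_tail_times_denominator[of c a "Suc (Suc N)" k]
    by (simp only: nat.case) algebra
  have "big_o_at_infinity (?t (Suc N) k * (?t (Suc (Suc N)) k * (?t N (k + 1) - ?t (Suc N) (k + 1))))
     (1 + (1 + (int N + 2)))"
    by (intro big_o_at_infinity_mult Suc.IH) (use jfraction_tail_leading in blast)+
  then show ?case
    unfolding eq by (simp add: big_o_at_infinity_def del: jfraction_tail.simps)
qed

lemma jfraction_tail_close:
  assumes "N \<le> M"
  shows "big_o_at_infinity (jfraction_tail c a N k - jfraction_tail c a M k) (int N + 2)"
  using assms
proof (induction M rule: dec_induct)
  case (step M)
  then show ?case
    using jfraction_tail_Suc_close[of c a M k] by (simp add: big_o_at_infinity_def del: jfraction_tail.simps)
qed (simp add: big_o_at_infinity_def)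

text \<open>Convergence in the adic metric is stabilisation of each coefficient, uniformly below any
  given order.\<close>

lemma tendsto_fls_iff_big_o:
  fixes X :: "nat \<Rightarrow> complex fls"
  shows "X \<longlonglongrightarrow> f \<longleftrightarrow> (\<forall>K::nat. \<forall>\<^sub>F N in sequentially. big_o_at_infinity (X N - f) (int K))"
proof
  assume *: "X \<longlonglongrightarrow> f"
  show "\<forall>K::nat. \<forall>\<^sub>F N in sequentially. big_o_at_infinity (X N - f) (int K)"
  proof
    fix K :: nat
    have "\<forall>\<^sub>F N in sequentially. dist (X N) f < inverse (2 ^ K)"
      using * by (simp add: tendsto_iff)
    then show "\<forall>\<^sub>F N in sequentially. big_o_at_infinity (X N - f) (int K)"
    proof eventually_elim
      case (elim N)
      have False if "X N \<noteq> f" "fls_subdegree (X N - f) < int K"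
      proof (cases "fls_subdegree (X N - f) \<ge> 0")
        case True
        then have "inverse (2 ^ K) \<le> (inverse (2 ^ nat (fls_subdegree (X N - f))) :: real)"
          using that by (intro le_imp_inverse_le power_increasing) auto
        then show False using elim that True by (simp add: dist_fls_def)
      next
        case False
        have "inverse (2 ^ K) \<le> (1 :: real)" "1 \<le> (2 ^ nat (- fls_subdegree (X N - f)) :: real)"
          by (simp_all add: inverse_le_1_iff)
        moreover have "dist (X N) f = 2 ^ nat (- fls_subdegree (X N - f))"
          using that False by (simp add: dist_fls_def)
        ultimately show False using elim by linarith
      qed
      then show ?case unfolding big_o_iff_subdegree by (cases "X N = f") force+
    qed
  qed
next
  assume *: "\<forall>K::nat. \<forall>\<^sub>F N in sequentially. big_o_at_infinity (X N - f) (int K)"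
  show "X \<longlonglongrightarrow> f"
    unfolding tendsto_iff
  proof (intro allI impI)
    fix e :: real assume "e > 0"
    then obtain K :: nat where K: "inverse (2 ^ K) < e"
      using real_arch_pow_inv[of e "1/2"] by (auto simp: power_one_over inverse_eq_divide)
    have "\<forall>\<^sub>F N in sequentially. big_o_at_infinity (X N - f) (int K)" using * by blast
    then show "\<forall>\<^sub>F N in sequentially. dist (X N) f < e"
    proof eventually_elim
      case (elim N)
      show ?case
      proof (cases "X N = f")
        case False
        then have le: "int K \<le> fls_subdegree (X N - f)" using elim by (simp add: big_o_iff_subdegree)
        then have "inverse (2 ^ nat (fls_subdegree (X N - f))) \<le> (inverse (2 ^ K) :: real)"
          by (intro le_imp_inverse_le power_increasing) auto
        moreover have "dist (X N) f = inverse (2 ^ nat (fls_subdegree (X N - f)))"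
          using le False by (simp add: dist_fls_def)
        ultimately show ?thesis using K by linarith
      qed (use \<open>e > 0\<close> in simp)
    qed
  qed
qed

text \<open>The limit is written down directly: by \<open>jfraction_tail_close\<close> the coefficient of \<open>1 / z ^ (k + 1)\<close>
  no longer changes from the convergent with index \<open>k\<close> on.\<close>

lemma has_jfraction_exists:
  assumes "\<forall>n\<ge>1. a n \<noteq> 0"
  shows "\<exists>s. has_jfraction (series_at_infinity s) c a"
proof -
  define s where "s k = - fls_nth (jfraction_tail c a k 0) (int k + 1)" for k
  have nth: "fls_nth (series_at_infinity s) i = (if i \<le> 0 then 0 else s (nat (i - 1)))" for i
    by (simp add: series_at_infinity_def fls_X_times_conv_shift(1))
  have "big_o_at_infinity (- jfraction_tail c a N 0 - series_at_infinity s) (int K)"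
    if "K \<le> N" for K N
    unfolding big_o_at_infinity_def
  proof (intro allI impI)
    fix i assume i: "i < int K"
    show "fls_nth (- jfraction_tail c a N 0 - series_at_infinity s) i = 0"
    proof (cases "i \<le> 0")
      case True
      then show ?thesis
        using jfraction_tail_leading[of c a N 0] by (simp add: nth big_o_at_infinity_def)
    next
      case False
      then have "big_o_at_infinity (jfraction_tail c a (nat (i - 1)) 0 - jfraction_tail c a N 0) (i + 1)"
        using jfraction_tail_close[of "nat (i - 1)" N c a 0] i that by (simp add: add_ac)
      then have "fls_nth (jfraction_tail c a (nat (i - 1)) 0) i = fls_nth (jfraction_tail c a N 0) i"
        by (simp add: big_o_at_infinity_def)
      with False show ?thesis by (simp add: nth s_def)
    qed
  qed
  then have "(\<lambda>N. - jfraction_tail c a N 0) \<longlonglongrightarrow> series_at_infinity s"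
    unfolding tendsto_fls_iff_big_o eventually_sequentially by blast
  with assms show ?thesis unfolding has_jfraction_def by blast
qed

text \<open>The case \<open>n = 0\<close> is kept apart because \<open>p (n - 1)\<close> is \<open>p 0\<close> there and \<open>a 0\<close> is arbitrary.\<close>

definition three_term_recurrence ::
  "(nat \<Rightarrow> complex) \<Rightarrow> (nat \<Rightarrow> complex) \<Rightarrow> (nat \<Rightarrow> complex poly) \<Rightarrow> bool" where
  "three_term_recurrence c a p \<longleftrightarrow> p 0 = 1 \<and>
    (\<forall>n. pCons 0 (p n) = p (Suc n) + smult (c n) (p n) + (if n = 0 then 0 else smult (a n) (p (n - 1))))"

text \<open>The analogue of the functions of the second kind, for a convergent in place of \<open>f\<close>: up to a
  polynomial, \<open>jfraction_remainder c a N n\<close> is \<open>jfraction_tail c a N 0\<close> times the \<open>n\<close>-th polynomial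
  of the three-term recurrence, see \<open>moment_of_convergent\<close> below. It is the
  product of \<open>n + 1\<close> tails, each with leading term \<open>1 / z\<close>, and of \<open>a 1, \<dots>, a n\<close>; this gives its leading term.\<close>

fun jfraction_remainder ::
  "(nat \<Rightarrow> complex) \<Rightarrow> (nat \<Rightarrow> complex) \<Rightarrow> nat \<Rightarrow> nat \<Rightarrow> complex fls" where
  "jfraction_remainder c a N 0 = jfraction_tail c a N 0"
| "jfraction_remainder c a N (Suc n) = fls_const (a (Suc n)) * jfraction_tail c a (N - Suc n) (Suc n) * jfraction_remainder c a N n"

lemma jfraction_remainder_leading:
  "big_o_at_infinity (jfraction_remainder c a N n) (int n + 1) \<and> fls_nth (jfraction_remainder c a N n) (int n + 1) = (\<Prod>i=1..n. a i)"
proof (induction n)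
  case 0
  show ?case using jfraction_tail_leading[of c a N 0] by simp
next
  case (Suc n)
  let ?t = "jfraction_tail c a (N - Suc n) (Suc n)"
  have t: "big_o_at_infinity ?t 1" "fls_nth ?t 1 = 1"
    using jfraction_tail_leading by blast+
  have c: "big_o_at_infinity (fls_const (a (Suc n))) 0"
    by (simp add: big_o_at_infinity_def fls_const_nth)
  have 1: "big_o_at_infinity (fls_const (a (Suc n)) * ?t) 1"
          "fls_nth (fls_const (a (Suc n)) * ?t) 1 = a (Suc n)"
    using big_o_at_infinity_mult[OF c t(1)] t(2) by simp_all
  show ?case
    using big_o_at_infinity_mult[OF 1(1), of "jfraction_remainder c a N n" "int n + 1"] Suc 1(2) by (simp add: add_ac mult.commute)
qed

text \<open>One division step of the continued fraction, multiplied by the preceding remainder. The constant 1 at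
  \<open>n = 0\<close> affects only the polynomial part.\<close>

lemma jfraction_remainder_recurrence:
  assumes "n < N"
  shows "fls_X_inv * jfraction_remainder c a N n = jfraction_remainder c a N (Suc n) + fls_const (c n) * jfraction_remainder c a N n +
     (if n = 0 then 1 else fls_const (a n) * jfraction_remainder c a N (n - 1))"
proof -
  obtain j where j: "N - n = Suc j" "N - Suc n = j" using assms by (metis Suc_diff_Suc)
  have *: "jfraction_tail c a (N - n) n * (fls_X_inv - fls_const (c n) - fls_const (a (Suc n)) * jfraction_tail c a (N - Suc n) (Suc n)) = 1"
    using jfraction_tail_times_denominator[of c a "Suc j" n] by (simp add: j del: jfraction_tail.simps)
  show ?thesis
  proof (cases n)
    case 0
    show ?thesis using * unfolding 0 by (simp del: jfraction_tail.simps) algebra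
  next
    case (Suc n')
    show ?thesis using * unfolding Suc by (simp del: jfraction_tail.simps) algebra
  qed
qed

text \<open>The polynomials and the remainders obey the same recurrence up to polynomial parts, and the
  moments see only the coefficients of negative powers of \<open>z\<close>.\<close>

lemma moment_of_convergent:
  assumes "three_term_recurrence c a p" "n \<le> N"
  shows "moment (jfraction_tail c a N 0) k (p n) = fls_nth (jfraction_remainder c a N n) (int k + 1)"
  using assms(2)
proof (induction n arbitrary: k rule: less_induct)
  case (less n)
  let ?f = "jfraction_tail c a N 0"
  show ?case
  proof (cases n)
    case 0
    then show ?thesis using assms(1)
      by (simp add: three_term_recurrence_def moment_def poly_at_infinity_pCons one_pCons)
  next
    case (Suc n')
    have p: "p n = pCons 0 (p n') - smult (c n') (p n') - (if n' = 0 then 0 else smult (a n') (p (n' - 1)))"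
      using assms(1) unfolding three_term_recurrence_def Suc by (simp add: algebra_simps)
    have r: "jfraction_remainder c a N n = fls_X_inv * jfraction_remainder c a N n' - fls_const (c n') * jfraction_remainder c a N n' -
       (if n' = 0 then 1 else fls_const (a n') * jfraction_remainder c a N (n' - 1))"
      using jfraction_remainder_recurrence[of n' N c a] less.prems unfolding Suc by (simp add: algebra_simps)
    have IH: "moment ?f k (p i) = fls_nth (jfraction_remainder c a N i) (int k + 1)" if "i < n" for i k
      using less that by simp
    have "moment ?f k (p n) = moment ?f (Suc k) (p n') - c n' * moment ?f k (p n') -
      (if n' = 0 then 0 else a n' * moment ?f k (p (n' - 1)))"
      unfolding p by simp
    also have "\<dots> = fls_nth (jfraction_remainder c a N n) (int k + 1)"
      unfolding r by (simp add: IH Suc fls_X_inv_times_conv_shift(1) add_ac)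
    finally show ?thesis .
  qed
qed

text \<open>A moment depends on finitely many coefficients of the series, which allows it to be computed on a convergent.\<close>

lemma moment_eq_if_close:
  assumes "big_o_at_infinity (f - g) (int (k + degree p) + 2)"
  shows "moment f k p = moment g k p"
proof -
  have "big_o_at_infinity (poly_at_infinity p) (- int (degree p))"
    by (auto simp: big_o_at_infinity_def fls_nth_poly_at_infinity coeff_eq_0)
  from big_o_at_infinity_mult(1)[OF assms this] have "big_o_at_infinity ((f - g) * poly_at_infinity p) (int k + 2)"
    by simp
  then show ?thesis by (simp add: moment_def big_o_at_infinity_def algebra_simps)
qed

text \<open>For a convergent of high index the moments of \<open>p n\<close> are coefficients of the remainder, which starts
  at order \<open>n + 1\<close> with coefficient \<open>a 1 * \<dots> * a n\<close>; and \<open>f\<close> agrees with the negative of that convergent as far as these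
  moments can see.\<close>

theorem jfraction_orthogonality:
  assumes f: "has_jfraction f c a" and p: "three_term_recurrence c a p"
  shows "orthogonal_below f n (p n)" "moment f n (p n) \<noteq> 0"
proof -
  have nz: "\<forall>n\<ge>1. a n \<noteq> 0" and lim: "(\<lambda>N. - jfraction_tail c a N 0) \<longlonglongrightarrow> f"
    using f by (auto simp: has_jfraction_def)
  have *: "moment f k (p n) = (if k = n then - (\<Prod>i=1..n. a i) else 0)" if "k \<le> n" for k
  proof -
    have "\<forall>\<^sub>F N in sequentially. big_o_at_infinity (- jfraction_tail c a N 0 - f) (int (k + degree (p n) + 2))"
      using lim[unfolded tendsto_fls_iff_big_o] by blast
    then have "\<forall>\<^sub>F N in sequentially. N \<ge> n \<and> big_o_at_infinity (- jfraction_tail c a N 0 - f) (int (k + degree (p n)) + 2)"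
      using eventually_ge_at_top[of n] by eventually_elim (simp add: add_ac)
    then obtain N where N: "N \<ge> n" "big_o_at_infinity (- jfraction_tail c a N 0 - f) (int (k + degree (p n)) + 2)"
      using eventually_happens sequentially_bot by blast
    have "moment f k (p n) = moment (- jfraction_tail c a N 0) k (p n)"
      using moment_eq_if_close[OF N(2)] by simp
    also have "\<dots> = - fls_nth (jfraction_remainder c a N n) (int k + 1)"
      using moment_of_convergent[OF p N(1), of k] by (simp add: moment_def)
    finally show ?thesis
      using jfraction_remainder_leading[of c a N n] that by (auto simp: big_o_at_infinity_def)
  qed
  show "orthogonal_below f n (p n)" by (simp add: orthogonal_below_def *)
  show "moment f n (p n) \<noteq> 0" using * nz by simp
qed

section \<open>Monic polynomials and three-term recurrences\<close>

fun three_term_poly :: "(nat \<Rightarrow> complex) \<Rightarrow> (nat \<Rightarrow> complex) \<Rightarrow> nat \<Rightarrow> complex poly" where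
  "three_term_poly c a 0 = 1"
| "three_term_poly c a (Suc n) = pCons 0 (three_term_poly c a n) - smult (c n) (three_term_poly c a n)
     - (if n = 0 then 0 else smult (a n) (three_term_poly c a (n - 1)))"

lemma three_term_recurrence_poly: "three_term_recurrence c a (three_term_poly c a)"
  by (auto simp: three_term_recurrence_def)

definition monic_of_degree :: "nat \<Rightarrow> complex poly \<Rightarrow> bool" where
  "monic_of_degree n p \<longleftrightarrow> degree p = n \<and> coeff p n = 1"

lemma monic_of_degree_add:
  assumes p: "monic_of_degree n p" and q: "degree q < n"
  shows "monic_of_degree n (p + q)"
proof -
  have "degree (p + q) = n"
    using degree_add_eq_left[of q p] p q by (simp add: monic_of_degree_def)
  moreover have "coeff q n = 0" using q by (rule coeff_eq_0)
  ultimately show ?thesis using p by (simp add: monic_of_degree_def)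
qed

lemma monic_of_degree_pCons:
  assumes "monic_of_degree n p"
  shows "monic_of_degree (Suc n) (pCons 0 p)"
proof -
  have "p \<noteq> 0" using assms by (auto simp: monic_of_degree_def)
  then show ?thesis using assms by (simp add: monic_of_degree_def degree_pCons_eq)
qed

lemma degree_diff_monic:
  assumes p: "monic_of_degree (Suc n) p" and q: "monic_of_degree (Suc n) q"
  shows "degree (p - q) \<le> n"
proof -
  have "degree (p - q) \<le> Suc n"
    using p q by (intro degree_diff_le) (simp_all add: monic_of_degree_def)
  moreover have "coeff (p - q) (Suc n) = 0"
    using p q by (simp add: monic_of_degree_def)
  ultimately show ?thesis
    by (metis Suc_leI Zero_not_Suc leading_coeff_0_iff degree_0 le_Suc_eq)
qed

lemma three_term_monic:
  assumes "three_term_recurrence c a p"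
  shows "monic_of_degree n (p n)"
proof (induction n rule: less_induct)
  case (less n)
  show ?case
  proof (cases n)
    case 0
    then show ?thesis using assms by (simp add: three_term_recurrence_def monic_of_degree_def)
  next
    case (Suc k)
    let ?q = "- smult (c k) (p k) - (if k = 0 then 0 else smult (a k) (p (k - 1)))"
    have p: "p n = pCons 0 (p k) + ?q"
      using assms unfolding three_term_recurrence_def Suc by (simp add: algebra_simps)
    have monic: "monic_of_degree k (p k)" and "monic_of_degree (k - 1) (p (k - 1))"
      using less[of k] less[of "k - 1"] Suc by simp_all
    then have "degree ?q \<le> k"
      by (intro degree_diff_le) (simp_all add: monic_of_degree_def)
    then show ?thesis
      unfolding p unfolding Suc by (intro monic_of_degree_add monic_of_degree_pCons monic) simp
  qed
qed

text \<open>Consecutive members of the sequence have different degrees, hence are linearly independent.\<close>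

lemma three_term_coefficients_unique:
  assumes "three_term_recurrence c a p" "three_term_recurrence c' a' p"
  shows "c n = c' n" "n \<ge> 1 \<Longrightarrow> a n = a' n"
proof -
  define t where "t u = (if n = 0 then 0 else smult (u n) (p (n - 1)))" for u :: "nat \<Rightarrow> complex"
  have "pCons 0 (p n) = p (Suc n) + smult (c n) (p n) + t a"
    "pCons 0 (p n) = p (Suc n) + smult (c' n) (p n) + t a'"
    using assms unfolding three_term_recurrence_def t_def by blast+
  then have "smult (c n) (p n) + t a = smult (c' n) (p n) + t a'"
    by (simp add: add.assoc)
  then have "smult (c n - c' n) (p n) = t a' - t a"
    unfolding smult_diff_left by (simp add: algebra_simps)
  also have "\<dots> = (if n = 0 then 0 else smult (a' n - a n) (p (n - 1)))"
    by (simp add: t_def smult_diff_left)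
  finally have eq: "smult (c n - c' n) (p n) = (if n = 0 then 0 else smult (a' n - a n) (p (n - 1)))" .
  have m: "monic_of_degree k (p k)" for k by (rule three_term_monic[OF assms(1)])
  have "coeff (smult (c n - c' n) (p n)) n = 0"
    unfolding eq using m[of "n - 1"] by (simp add: monic_of_degree_def coeff_eq_0)
  then show c: "c n = c' n" using m[of n] by (simp add: monic_of_degree_def)
  assume "n \<ge> 1"
  then have "smult (a' n - a n) (p (n - 1)) = 0" using eq c by simp
  moreover have "p (n - 1) \<noteq> 0" using m[of "n - 1"] by (auto simp: monic_of_degree_def)
  ultimately show "a n = a' n" by simp
qed

section \<open>Perfect systems and multiple orthogonal polynomials\<close>

definition multiple_orthogonal ::
  "complex fls \<Rightarrow> complex fls \<Rightarrow> (nat \<Rightarrow> nat \<Rightarrow> complex poly) \<Rightarrow> bool" where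
  "multiple_orthogonal f1 f2 P \<longleftrightarrow> (\<forall>n m. monic_of_degree (n + m) (P n m) \<and>
     orthogonal_below f1 n (P n m) \<and> orthogonal_below f2 m (P n m) \<and>
     moment f1 n (P n m) \<noteq> 0 \<and> moment f2 m (P n m) \<noteq> 0)"

lemma orthogonal_below_mono: "orthogonal_below f n p \<Longrightarrow> k \<le> n \<Longrightarrow> orthogonal_below f k p"
  by (simp add: orthogonal_below_def)

lemma orthogonal_below_lincomb [intro]:
  "orthogonal_below f n p \<Longrightarrow> orthogonal_below f n q \<Longrightarrow> orthogonal_below f n (p + q)"
  "orthogonal_below f n p \<Longrightarrow> orthogonal_below f n q \<Longrightarrow> orthogonal_below f n (p - q)"
  "orthogonal_below f n p \<Longrightarrow> orthogonal_below f n (smult c p)"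
  by (simp_all add: orthogonal_below_def)

text \<open>Subtracting a multiple of \<open>P n m\<close> leaves a polynomial \<open>r\<close> of degree below \<open>n + m\<close>. If \<open>n > 0\<close>, then
  \<open>r\<close> satisfies the conditions at \<open>(n - 1, m)\<close>, so by induction it is a multiple of \<open>P (n - 1) m\<close>.
  But its moment with index \<open>n - 1\<close> vanishes while that of \<open>P (n - 1) m\<close> does not, so \<open>r = 0\<close>. The
  case \<open>m > 0\<close> is the same with the second series.\<close>

lemma multiple_orthogonal_unique:
  assumes P: "multiple_orthogonal f1 f2 P"
    and "degree q \<le> n + m" "orthogonal_below f1 n q" "orthogonal_below f2 m q"
  shows "q = smult (coeff q (n + m)) (P n m)"
  using assms(2-)
proof (induction "n + m" arbitrary: n m q rule: less_induct)
  case less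
  define r where "r = q - smult (coeff q (n + m)) (P n m)"
  have Pnm: "monic_of_degree (n + m) (P n m)" "orthogonal_below f1 n (P n m)" "orthogonal_below f2 m (P n m)"
    and nz: "\<And>n m. moment f1 n (P n m) \<noteq> 0" "\<And>n m. moment f2 m (P n m) \<noteq> 0"
    using P by (auto simp: multiple_orthogonal_def)
  have orth: "orthogonal_below f1 n r" "orthogonal_below f2 m r"
    unfolding r_def using less.prems Pnm by blast+
  have "coeff r i = 0" if "i \<ge> n + m" for i
    using that less.prems(1) Pnm(1)
    by (cases "i = n + m") (auto simp: r_def monic_of_degree_def coeff_eq_0)
  then have deg: "r = 0 \<or> degree r < n + m"
    using leading_coeff_0_iff not_le by blast
  have "r = 0"
  proof (rule ccontr)
    assume r: "r \<noteq> 0"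
    with deg consider n' where "n = Suc n'" | m' where "m = Suc m'"
      by (metis add_is_0 not0_implies_Suc not_less_zero)
    then show False
    proof cases
      case 1
      then have "r = smult (coeff r (n' + m)) (P n' m)"
        using deg orth r by (intro less.hyps) (auto intro: orthogonal_below_mono)
      moreover from this have "coeff r (n' + m) * moment f1 n' (P n' m) = 0"
        using orth(1) 1 by (metis lessI moment_smult orthogonal_below_def)
      ultimately show False using nz r by (metis mult_eq_0_iff smult_0_left)
    next
      case 2
      then have "r = smult (coeff r (n + m')) (P n m')"
        using deg orth r by (intro less.hyps) (auto intro: orthogonal_below_mono)
      moreover from this have "coeff r (n + m') * moment f2 m' (P n m') = 0"
        using orth(2) 2 by (metis lessI moment_smult orthogonal_below_def)
      ultimately show False using nz r by (metis mult_eq_0_iff smult_0_left)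
    qed
  qed
  then show ?case by (simp add: r_def)
qed

text \<open>In a perfect system the next moments cannot vanish, since \<open>P n m\<close> would then be a solution for
  \<open>(n + 1, m)\<close> or \<open>(n, m + 1)\<close> of too small a degree.\<close>

theorem perfect_system_iff_multiple_orthogonal:
  "perfect_system f1 f2 \<longleftrightarrow> (\<exists>P. multiple_orthogonal f1 f2 P)"
proof
  assume perfect: "perfect_system f1 f2"
  have deg: "degree p = n + m" if "hermite_pade_poly f1 f2 n m p" for n m p
    using perfect that by (auto simp: perfect_system_def normal_index_def)
  have "\<exists>p. monic_of_degree (n + m) p \<and> orthogonal_below f1 n p \<and> orthogonal_below f2 m p \<and>
      moment f1 n p \<noteq> 0 \<and> moment f2 m p \<noteq> 0" for n m
  proof -
    obtain q where q: "hermite_pade_poly f1 f2 n m q"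
      using perfect unfolding perfect_system_def normal_index_def by blast
    define p where "p = smult (inverse (lead_coeff q)) q"
    have hp: "hermite_pade_poly f1 f2 n m p"
      using q by (auto simp: hermite_pade_poly_iff p_def)
    have "lead_coeff q \<noteq> 0" using q by (simp add: hermite_pade_poly_iff)
    then have monic: "monic_of_degree (n + m) p"
      using deg[OF q] by (simp add: p_def monic_of_degree_def)
    have "\<not> hermite_pade_poly f1 f2 (Suc n) m p" "\<not> hermite_pade_poly f1 f2 n (Suc m) p"
      using deg[of "Suc n" m p] deg[of n "Suc m" p] deg[OF hp] by auto
    then have "moment f1 n p \<noteq> 0" "moment f2 m p \<noteq> 0"
      using hp by (auto simp: hermite_pade_poly_iff orthogonal_below_def less_Suc_eq)
    with monic hp show ?thesis by (auto simp: hermite_pade_poly_iff)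
  qed
  then show "\<exists>P. multiple_orthogonal f1 f2 P"
    unfolding multiple_orthogonal_def by metis
next
  assume "\<exists>P. multiple_orthogonal f1 f2 P"
  then obtain P where P: "multiple_orthogonal f1 f2 P" by blast
  have nz: "P n m \<noteq> 0" for n m
  proof -
    have "coeff (P n m) (n + m) = 1"
      using P by (simp add: multiple_orthogonal_def monic_of_degree_def)
    then show ?thesis by auto
  qed
  have uniq: "p = smult (coeff p (n + m)) (P n m)" if "hermite_pade_poly f1 f2 n m p" for n m p
    using multiple_orthogonal_unique[OF P] that by (simp add: hermite_pade_poly_iff)
  have "hermite_pade_poly f1 f2 n m (P n m)" for n m
    using P nz by (simp add: hermite_pade_poly_iff multiple_orthogonal_def monic_of_degree_def)
  moreover have "degree p = n + m" if "hermite_pade_poly f1 f2 n m p" for n m p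
  proof -
    have "p \<noteq> 0" using that by (simp add: hermite_pade_poly_iff)
    then have "coeff p (n + m) \<noteq> 0" using uniq[OF that] by (metis smult_0_left)
    then show ?thesis using that by (auto simp: hermite_pade_poly_iff intro: le_antisym le_degree)
  qed
  ultimately show "perfect_system f1 f2"
    unfolding perfect_system_def normal_index_def using uniq by blast
qed

section \<open>Nearest-neighbour recurrences\<close>

text \<open>The recurrence in the second direction is replaced by its difference from the first one. At the
  boundary, where \<open>n - 1\<close> or \<open>m - 1\<close> is truncated, the coefficient \<open>a 0 m\<close> or \<open>b n 0\<close> will be zero.\<close>

definition nearest_neighbour ::
  "(nat \<Rightarrow> nat \<Rightarrow> complex) \<Rightarrow> (nat \<Rightarrow> nat \<Rightarrow> complex) \<Rightarrow> (nat \<Rightarrow> nat \<Rightarrow> complex) \<Rightarrow>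
   (nat \<Rightarrow> nat \<Rightarrow> complex) \<Rightarrow> (nat \<Rightarrow> nat \<Rightarrow> complex poly) \<Rightarrow> bool" where
  "nearest_neighbour a b c d P \<longleftrightarrow>
    (\<forall>n m. pCons 0 (P n m) = P (Suc n) m + smult (c n m) (P n m) + smult (a n m) (P (n - 1) m) +
       smult (b n m) (P n (m - 1))) \<and>
    (\<forall>n m. P n (Suc m) = P (Suc n) m + smult (c n m - d n m) (P n m))"

text \<open>Multiplication by \<open>x\<close> is expanded on \<open>P n (m+1)\<close> through row \<open>m\<close>. The equations for \<open>a\<close>
  and \<open>b\<close> turn the terms with \<open>n - 1\<close> and \<open>m - 1\<close> into those of the recurrence in row \<open>m + 1\<close>, and
  what is left is a combination of \<open>P (n+1) m\<close> and \<open>P n m\<close>. Its coefficients vanish exactly if, with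
  \<open>e = c - d\<close>, the equations for \<open>c\<close> and \<open>d\<close> hold. So the lemma serves both to derive these equations, when row
  \<open>m + 1\<close> is known to satisfy the recurrence, and to derive the recurrence from them.\<close>

lemma recurrence_defect:
  fixes a b c e :: "nat \<Rightarrow> nat \<Rightarrow> complex"
  assumes E: "\<And>n m. P n (Suc m) = P (Suc n) m + smult (e n m) (P n m)"
    and R: "\<And>n. pCons 0 (P n m) = P (Suc n) m + smult (c n m) (P n m) + smult (a n m) (P (n - 1) m) +
       smult (b n m) (P n (m - 1))"
    and A: "n \<ge> 1 \<Longrightarrow> a n (Suc m) * e (n - 1) m = a n m * e n m" "\<And>m. a 0 m = 0"
    and B: "m \<ge> 1 \<Longrightarrow> b (Suc n) m * e n (m - 1) = b n m * e n m" "\<And>n. b n 0 = 0"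
  shows "pCons 0 (P n (Suc m)) =
     P (Suc n) (Suc m) + smult (c n (Suc m)) (P n (Suc m)) + smult (a n (Suc m)) (P (n - 1) (Suc m)) +
       smult (b n (Suc m)) (P n m) +
     (smult (c (Suc n) m + e n m - e (Suc n) m - c n (Suc m)) (P (Suc n) m) +
      smult (a (Suc n) m + b (Suc n) m + e n m * c n m - c n (Suc m) * e n m - a n (Suc m) - b n (Suc m))
        (P n m))"
proof -
  have T1: "smult (a n m * e n m) (P (n - 1) m) = smult (a n (Suc m)) (P (n - 1) (Suc m) - P n m)"
  proof (cases n)
    case (Suc k)
    have "smult (a n m * e n m) (P k m) = smult (a n (Suc m)) (smult (e k m) (P k m))"
      using A(1) Suc by simp
    then show ?thesis using E[of k m] Suc by simp
  qed (simp add: A(2))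
  have T2: "smult (b (Suc n) m) (P (Suc n) (m - 1)) + smult (e n m * b n m) (P n (m - 1)) =
      smult (b (Suc n) m) (P n m)"
  proof (cases m)
    case (Suc k)
    have "smult (e n m * b n m) (P n k) = smult (b (Suc n) m) (smult (e n k) (P n k))"
      using B(1) Suc by (simp add: mult.commute)
    then show ?thesis using E[of n k] Suc by (simp add: smult_add_right)
  qed (simp add: B(2))
  have "pCons 0 (P n (Suc m)) = pCons 0 (P (Suc n) m) + smult (e n m) (pCons 0 (P n m))"
    by (simp add: E)
  also have "\<dots> = P (Suc (Suc n)) m + smult (c (Suc n) m + e n m) (P (Suc n) m) +
      smult (a (Suc n) m + e n m * c n m) (P n m) + smult (a n m * e n m) (P (n - 1) m) +
      (smult (b (Suc n) m) (P (Suc n) (m - 1)) + smult (e n m * b n m) (P n (m - 1)))"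
    unfolding R by (simp add: smult_add_right smult_add_left mult.commute add_ac)
  also have "\<dots> = P (Suc (Suc n)) m + smult (c (Suc n) m + e n m) (P (Suc n) m) +
      smult (a (Suc n) m + b (Suc n) m - a n (Suc m) + e n m * c n m) (P n m) +
      smult (a n (Suc m)) (P (n - 1) (Suc m))"
    unfolding T1 T2
    by (simp add: smult_add_left smult_diff_left smult_diff_right)
  finally show ?thesis
    by (simp add: E smult_add_left smult_add_right smult_diff_left algebra_simps)
qed

text \<open>For each of the two series, one moment keeps \<open>x P n m - P (n+1) m\<close> from satisfying the conditions at
  \<open>(n, m)\<close>. Subtracting \<open>a n m P (n-1) m\<close> and \<open>b n m P n (m-1)\<close>, with quotients of next moments as
  coefficients, removes both of them, and by uniqueness the result is a multiple of \<open>P n m\<close>.\<close>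

theorem multiple_orthogonal_imp_difference_system:
  assumes mo: "multiple_orthogonal f1 f2 P"
  shows "\<exists>a b c d. difference_system a b c d \<and> nearest_neighbour a b c d P \<and>
    (\<forall>m. a 0 m = 0) \<and> (\<forall>n. b n 0 = 0) \<and>
    (\<forall>n m. n \<ge> 1 \<longrightarrow> a n m \<noteq> 0) \<and> (\<forall>n m. m \<ge> 1 \<longrightarrow> b n m \<noteq> 0)"
proof -
  have monic: "monic_of_degree (n + m) (P n m)"
    and orth: "k < n \<Longrightarrow> moment f1 k (P n m) = 0" "k < m \<Longrightarrow> moment f2 k (P n m) = 0"
    and nz: "moment f1 n (P n m) \<noteq> 0" "moment f2 m (P n m) \<noteq> 0" for n m k
    using mo by (auto simp: multiple_orthogonal_def orthogonal_below_def)
  have deg: "degree (P n m) = n + m" for n m using monic by (simp add: monic_of_degree_def)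
  \<comment> \<open>the next moments\<close>
  define h1 h2 where "h1 n m = moment f1 n (P n m)" and "h2 n m = moment f2 m (P n m)" for n m
  have "\<exists>e. P n (Suc m) - P (Suc n) m = smult e (P n m)" for n m
  proof -
    have "degree (P n (Suc m) - P (Suc n) m) \<le> n + m"
      using monic[of n "Suc m"] monic[of "Suc n" m] by (intro degree_diff_monic) simp_all
    then show ?thesis
      using multiple_orthogonal_unique[OF mo, of "P n (Suc m) - P (Suc n) m" n m]
      by (auto simp: orthogonal_below_def orth)
  qed
  then obtain e where "\<And>n m. P n (Suc m) - P (Suc n) m = smult (e n m) (P n m)" by metis
  then have E: "P n (Suc m) = P (Suc n) m + smult (e n m) (P n m)" for n m
    by (metis add.commute diff_add_cancel)
  have h1: "h1 n (Suc m) = e n m * h1 n m" for n m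
    unfolding h1_def E by (simp add: orth)
  have h2: "h2 (Suc n) m = - e n m * h2 n m" for n m
    using arg_cong[OF E[of n m], of "moment f2 m"] unfolding h2_def
    by (simp add: orth eq_neg_iff_add_eq_0)
  have h_nz: "h1 n m \<noteq> 0" "h2 n m \<noteq> 0" for n m by (simp_all add: h1_def h2_def nz)
  have e_nz: "e n m \<noteq> 0" for n m using h1[of n m] h_nz by auto
  define a b where "a n m = (if n = 0 then 0 else h1 n m / h1 (n - 1) m)"
    and "b n m = (if m = 0 then 0 else h2 n m / h2 n (m - 1))" for n m
  have "\<exists>c. pCons 0 (P n m) - P (Suc n) m - smult (a n m) (P (n - 1) m) - smult (b n m) (P n (m - 1)) =
      smult c (P n m)" for n m
  proof -
    let ?Y = "pCons 0 (P n m) - P (Suc n) m - smult (a n m) (P (n - 1) m) - smult (b n m) (P n (m - 1))"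
    have "degree (pCons 0 (P n m) - P (Suc n) m) \<le> n + m"
      using monic_of_degree_pCons[OF monic[of n m]] monic[of "Suc n" m]
      by (intro degree_diff_monic) simp_all
    moreover have "degree (smult (a n m) (P (n - 1) m)) \<le> n + m"
        "degree (smult (b n m) (P n (m - 1))) \<le> n + m"
      by (rule order_trans[OF degree_smult_le], simp add: deg)+
    ultimately have "degree ?Y \<le> n + m"
      using degree_diff_le by blast
    moreover have "orthogonal_below f1 n ?Y"
      unfolding orthogonal_below_def
    proof (intro allI impI)
      fix k assume k: "k < n"
      then show "moment f1 k ?Y = 0"
        using h_nz by (cases "Suc k = n") (auto simp: orth a_def h1_def)
    qed
    moreover have "orthogonal_below f2 m ?Y"
      unfolding orthogonal_below_def
    proof (intro allI impI)
      fix k assume k: "k < m"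
      then show "moment f2 k ?Y = 0"
        using h_nz by (cases "Suc k = m") (auto simp: orth b_def h2_def)
    qed
    ultimately show ?thesis using multiple_orthogonal_unique[OF mo] by blast
  qed
  then obtain c where c: "\<And>n m. pCons 0 (P n m) - P (Suc n) m - smult (a n m) (P (n - 1) m) -
      smult (b n m) (P n (m - 1)) = smult (c n m) (P n m)" by metis
  have R: "pCons 0 (P n m) = P (Suc n) m + smult (c n m) (P n m) + smult (a n m) (P (n - 1) m) +
       smult (b n m) (P n (m - 1))" for n m
    using c[of n m] by (simp add: algebra_simps)
  have A: "a n (Suc m) * e (n - 1) m = a n m * e n m" if "n \<ge> 1" for n m
    using that h1[of n m] h1[of "n - 1" m] h_nz e_nz by (simp add: a_def)
  have B: "b (Suc n) m * e n (m - 1) = b n m * e n m" if "m \<ge> 1" for n m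
    using that h2[of n m] h2[of n "m - 1"] h_nz e_nz by (simp add: b_def)
  \<comment> \<open>the two correction terms have different degrees, so both must vanish\<close>
  have compat: "c (Suc n) m + e n m - e (Suc n) m - c n (Suc m) = 0 \<and>
    a (Suc n) m + b (Suc n) m + e n m * c n m - c n (Suc m) * e n m - a n (Suc m) - b n (Suc m) = 0"
    (is "?u = 0 \<and> ?v = 0") for n m
  proof -
    have "pCons 0 (P n (Suc m)) = P (Suc n) (Suc m) + smult (c n (Suc m)) (P n (Suc m)) +
        smult (a n (Suc m)) (P (n - 1) (Suc m)) + smult (b n (Suc m)) (P n m) +
        (smult ?u (P (Suc n) m) + smult ?v (P n m))"
      using E R A B by (intro recurrence_defect) (auto simp: a_def b_def)
    then have *: "smult ?u (P (Suc n) m) + smult ?v (P n m) = 0"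
      using R[of n "Suc m"] by simp
    have "coeff (smult ?u (P (Suc n) m) + smult ?v (P n m)) (Suc n + m) = ?u"
      using monic[of "Suc n" m] deg[of n m] by (simp add: monic_of_degree_def coeff_eq_0)
    with * have u: "?u = 0" by simp
    with * have "smult ?v (P n m) = 0" by simp
    then show ?thesis using u monic[of n m] by (auto simp: monic_of_degree_def)
  qed
  define d where "d n m = c n m - e n m" for n m
  have cd: "c n m - d n m = e n m" for n m by (simp add: d_def)
  have "difference_system a b c d"
    unfolding difference_system_iff_products cd
    using e_nz compat A B by (simp add: d_def algebra_simps)
  moreover have "nearest_neighbour a b c d P"
    unfolding nearest_neighbour_def cd using R E by blast
  ultimately show ?thesis
    using h_nz by (intro exI[of _ a] exI[of _ b] exI[of _ c] exI[of _ d]) (simp add: a_def b_def)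
qed

lemma nearest_neighbour_boundary:
  assumes "nearest_neighbour a b c d P" "P 0 0 = 1" "\<forall>m. a 0 m = 0" "\<forall>n. b n 0 = 0"
  shows "three_term_recurrence (\<lambda>n. c n 0) (\<lambda>n. a n 0) (\<lambda>n. P n 0)"
    "three_term_recurrence (d 0) (b 0) (P 0)"
proof -
  have R: "pCons 0 (P n m) = P (Suc n) m + smult (c n m) (P n m) + smult (a n m) (P (n - 1) m) +
       smult (b n m) (P n (m - 1))"
    and E: "P n (Suc m) = P (Suc n) m + smult (c n m - d n m) (P n m)" for n m
    using assms(1) by (auto simp: nearest_neighbour_def)
  show "three_term_recurrence (\<lambda>n. c n 0) (\<lambda>n. a n 0) (\<lambda>n. P n 0)"
    using assms(2-) R[of _ 0] by (auto simp: three_term_recurrence_def)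
  have "pCons 0 (P 0 m) = P 0 (Suc m) + smult (d 0 m) (P 0 m) + smult (b 0 m) (P 0 (m - 1))" for m
    using assms(3) R[of 0 m] E[of 0 m] by (simp add: smult_diff_left)
  then show "three_term_recurrence (d 0) (b 0) (P 0)"
    using assms(2,4) by (auto simp: three_term_recurrence_def)
qed

section \<open>From the difference system to a perfect system\<close>

text \<open>The array is filled row by row from its values on the axis \<open>m = 0\<close>.\<close>

fun path_poly :: "(nat \<Rightarrow> complex poly) \<Rightarrow> (nat \<Rightarrow> nat \<Rightarrow> complex) \<Rightarrow> nat \<Rightarrow> nat \<Rightarrow> complex poly" where
  "path_poly p e n 0 = p n"
| "path_poly p e n (Suc m) = path_poly p e (Suc n) m + smult (e n m) (path_poly p e n m)"

text \<open>Induction on \<open>m\<close>: for a solution of the system, the defect in \<open>recurrence_defect\<close> is zero.\<close>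

lemma path_poly_nearest_neighbour:
  assumes sys: "difference_system a b c d" and "\<forall>m. a 0 m = 0" "\<forall>n. b n 0 = 0"
    and p: "three_term_recurrence (\<lambda>n. c n 0) (\<lambda>n. a n 0) p"
  shows "nearest_neighbour a b c d (path_poly p (\<lambda>n m. c n m - d n m))"
proof -
  define e where "e n m = c n m - d n m" for n m
  define P where "P = path_poly p e"
  have c: "c n (Suc m) - d (Suc n) m = e n m \<and>
      (c n (Suc m) - c n m) * e n m = (a (Suc n) m + b (Suc n) m) - (a n (Suc m) + b n (Suc m))"
    and A: "n \<ge> 1 \<Longrightarrow> a n (Suc m) * e (n - 1) m = a n m * e n m"
    and B: "m \<ge> 1 \<Longrightarrow> b (Suc n) m * e n (m - 1) = b n m * e n m" for n m
    using sys by (simp_all add: difference_system_iff_products e_def)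
  have E: "P n (Suc m) = P (Suc n) m + smult (e n m) (P n m)" for n m
    by (simp add: P_def)
  have u: "c (Suc n) m + e n m - e (Suc n) m - c n (Suc m) = 0" for n m
    using c[of n m] by (simp add: e_def algebra_simps)
  have v: "a (Suc n) m + b (Suc n) m + e n m * c n m - c n (Suc m) * e n m - a n (Suc m) - b n (Suc m) = 0" for n m
    using conjunct2[OF c[of n m]] by algebra
  have "pCons 0 (P n m) = P (Suc n) m + smult (c n m) (P n m) + smult (a n m) (P (n - 1) m) +
       smult (b n m) (P n (m - 1))" for n m
  proof (induction m arbitrary: n)
    case 0
    then show ?case using p assms(2,3) by (simp add: P_def three_term_recurrence_def)
  next
    case (Suc m)
    have "pCons 0 (P n (Suc m)) =
       P (Suc n) (Suc m) + smult (c n (Suc m)) (P n (Suc m)) + smult (a n (Suc m)) (P (n - 1) (Suc m)) +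
       smult (b n (Suc m)) (P n m) +
       (smult (c (Suc n) m + e n m - e (Suc n) m - c n (Suc m)) (P (Suc n) m) +
        smult (a (Suc n) m + b (Suc n) m + e n m * c n m - c n (Suc m) * e n m - a n (Suc m) - b n (Suc m))
        (P n m))"
      using assms(2,3) by (intro recurrence_defect E Suc.IH A B) auto
    then show ?case by (simp add: u v)
  qed
  then show ?thesis
    using E unfolding nearest_neighbour_def P_def e_def by blast
qed

text \<open>Orthogonality for \<open>f1\<close> starts from the axis \<open>m = 0\<close> and moves upwards, that for \<open>f2\<close> starts from
  the axis \<open>n = 0\<close> and moves to the right; in both cases \<open>P (n+1) m\<close> and \<open>P n (m+1)\<close> differ by a nonzero
  multiple of \<open>P n m\<close>, whose next moment is nonzero.\<close>

theorem nearest_neighbour_imp_multiple_orthogonal: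
  assumes nn: "nearest_neighbour a b c d P" and nz: "\<And>n m. c n m \<noteq> d n m"
    and "P 0 0 = 1" "\<forall>m. a 0 m = 0" "\<forall>n. b n 0 = 0"
    and f1: "has_jfraction f1 (\<lambda>n. c n 0) (\<lambda>n. a n 0)" and f2: "has_jfraction f2 (d 0) (b 0)"
  shows "multiple_orthogonal f1 f2 P"
proof -
  note tt = nearest_neighbour_boundary[OF nn assms(3-5)]
  have E: "P n (Suc m) = P (Suc n) m + smult (c n m - d n m) (P n m)" for n m
    using nn by (simp add: nearest_neighbour_def)
  have E': "P (Suc n) m = P n (Suc m) + smult (d n m - c n m) (P n m)" for n m
    by (simp add: E smult_diff_left)
  have "monic_of_degree (n + m) (P n m)" for n m
  proof (induction m arbitrary: n)
    case 0
    then show ?case using three_term_monic[OF tt(1)] by simp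
  next
    case (Suc m)
    show ?case unfolding E
      by (intro monic_of_degree_add)
        (use Suc[of "Suc n"] Suc[of n] in \<open>auto simp: monic_of_degree_def\<close>)
  qed
  moreover have "orthogonal_below f1 n (P n m) \<and> moment f1 n (P n m) \<noteq> 0" for n m
  proof (induction m arbitrary: n)
    case 0
    then show ?case using jfraction_orthogonality[OF f1 tt(1)] by blast
  next
    case (Suc m)
    show ?case using Suc[of n] Suc[of "Suc n"] nz[of n m] unfolding E orthogonal_below_def by auto
  qed
  moreover have "orthogonal_below f2 m (P n m) \<and> moment f2 m (P n m) \<noteq> 0" for n m
  proof (induction n arbitrary: m)
    case 0
    then show ?case using jfraction_orthogonality[OF f2 tt(2)] by blast
  next
    case (Suc n)
    show ?case using Suc[of m] Suc[of "Suc m"] nz[of n m] unfolding E' orthogonal_below_def by auto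
  qed
  ultimately show ?thesis unfolding multiple_orthogonal_def by blast
qed

lemma has_jfraction_cong:
  "\<lbrakk>\<And>n. c n = c' n; \<And>n. n \<ge> 1 \<Longrightarrow> a n = a' n\<rbrakk> \<Longrightarrow> has_jfraction f c a \<longleftrightarrow> has_jfraction f c' a'"
proof -
  assume *: "\<And>n. c n = c' n" "\<And>n. n \<ge> 1 \<Longrightarrow> a n = a' n"
  have "jfraction_tail c a N k = jfraction_tail c' a' N k" for N k
    by (induction N arbitrary: k) (simp_all add: *)
  then show ?thesis using * by (auto simp: has_jfraction_def)
qed

text \<open>From a perfect system the initial data are recovered because the polynomials on each axis are
  the orthogonal polynomials of one series, and these determine the coefficients of their
  recurrence. In the other direction, the nonvanishing of \<open>a\<close> and \<open>b\<close> off the axes extends to the axes, where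
  the J-fractions need it, since \<open>a n 1\<close> is a multiple of \<open>a n 0\<close>, and \<open>b 1 m\<close> of \<open>b 0 m\<close>.\<close>

theorem difference_system_iff_perfect_system:
  "(\<exists>a b c d :: nat \<Rightarrow> nat \<Rightarrow> complex.
            difference_system a b c d \<and>
            (\<forall>n. c n 0 = c0 n) \<and> (\<forall>n\<ge>1. a n 0 = a0 n) \<and>
            (\<forall>m. d 0 m = d0 m) \<and> (\<forall>m\<ge>1. b 0 m = b0 m) \<and>
            (\<forall>m. a 0 m = 0) \<and> (\<forall>n. b n 0 = 0) \<and>
            (\<forall>n m. n > 0 \<and> m > 0 \<longrightarrow> a n m \<noteq> 0 \<and> b n m \<noteq> 0))
        \<longleftrightarrow> corresponds_to_perfect_system c0 a0 d0 b0" (is "?lhs \<longleftrightarrow> ?rhs")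
proof
  assume ?lhs
  then show ?rhs
  proof (elim exE conjE)
    fix a b c d :: "nat \<Rightarrow> nat \<Rightarrow> complex"
    assume sys: "difference_system a b c d"
      and init: "\<forall>n. c n 0 = c0 n" "\<forall>n\<ge>1. a n 0 = a0 n" "\<forall>m. d 0 m = d0 m" "\<forall>m\<ge>1. b 0 m = b0 m"
      and bdry: "\<forall>m. a 0 m = 0" "\<forall>n. b n 0 = 0"
      and nz: "\<forall>n m. n > 0 \<and> m > 0 \<longrightarrow> a n m \<noteq> 0 \<and> b n m \<noteq> 0"
    have ne: "c n m \<noteq> d n m" for n m using sys by (auto simp: difference_system_def)
    have A: "n \<ge> 1 \<Longrightarrow> a n (Suc m) * (c (n - 1) m - d (n - 1) m) = a n m * (c n m - d n m)"
      and B: "m \<ge> 1 \<Longrightarrow> b (Suc n) m * (c n (m - 1) - d n (m - 1)) = b n m * (c n m - d n m)" for n m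
      using sys by (simp_all add: difference_system_iff_products)
    have a_nz: "a n 0 \<noteq> 0" if "n \<ge> 1" for n
      using A[of n 0] nz[rule_format, of n 1] ne that by auto
    have b_nz: "b 0 m \<noteq> 0" if "m \<ge> 1" for m
      using B[of m 0] nz[rule_format, of 1 m] ne that by auto
    obtain s1 where s1: "has_jfraction (series_at_infinity s1) (\<lambda>n. c n 0) (\<lambda>n. a n 0)"
      using has_jfraction_exists[of "\<lambda>n. a n 0"] a_nz by blast
    obtain s2 where s2: "has_jfraction (series_at_infinity s2) (d 0) (b 0)"
      using has_jfraction_exists[of "b 0"] b_nz by blast
    let ?P = "path_poly (three_term_poly (\<lambda>n. c n 0) (\<lambda>n. a n 0)) (\<lambda>n m. c n m - d n m)"
    have "multiple_orthogonal (series_at_infinity s1) (series_at_infinity s2) ?P"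
      using path_poly_nearest_neighbour[OF sys bdry three_term_recurrence_poly]
      by (rule nearest_neighbour_imp_multiple_orthogonal) (use ne bdry s1 s2 in simp_all)
    moreover have "has_jfraction (series_at_infinity s1) c0 a0"
      using s1 has_jfraction_cong[of "\<lambda>n. c n 0" c0 "\<lambda>n. a n 0" a0] init by simp
    moreover have "has_jfraction (series_at_infinity s2) d0 b0"
      using s2 has_jfraction_cong[of "d 0" d0 "b 0" b0] init by simp
    ultimately show ?rhs
      unfolding corresponds_to_perfect_system_def perfect_system_iff_multiple_orthogonal by blast
  qed
next
  assume ?rhs
  then obtain f1 f2 P where P: "multiple_orthogonal f1 f2 P"
    and f1: "has_jfraction f1 c0 a0" and f2: "has_jfraction f2 d0 b0"
    unfolding corresponds_to_perfect_system_def perfect_system_iff_multiple_orthogonal by blast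
  from multiple_orthogonal_imp_difference_system[OF P] show ?lhs
  proof (elim exE conjE)
    fix a b c d :: "nat \<Rightarrow> nat \<Rightarrow> complex"
    assume sys: "difference_system a b c d" and nn: "nearest_neighbour a b c d P"
      and bdry: "\<forall>m. a 0 m = 0" "\<forall>n. b n 0 = 0"
      and nz: "\<forall>n m. n \<ge> 1 \<longrightarrow> a n m \<noteq> 0" "\<forall>n m. m \<ge> 1 \<longrightarrow> b n m \<noteq> 0"
    have "monic_of_degree 0 (P 0 0)"
      using P[unfolded multiple_orthogonal_def, rule_format, of 0 0] by simp
    then have "P 0 0 = 1" by (auto simp: monic_of_degree_def one_pCons elim!: degree_eq_zeroE)
    note tt = nearest_neighbour_boundary[OF nn this bdry]
    have p1: "three_term_poly c0 a0 n = P n 0" for n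
    proof -
      have "monic_of_degree n (three_term_poly c0 a0 n)"
        by (rule three_term_monic[OF three_term_recurrence_poly])
      then show ?thesis
        using multiple_orthogonal_unique[OF P, of "three_term_poly c0 a0 n" n 0]
          jfraction_orthogonality(1)[OF f1 three_term_recurrence_poly, of n]
        by (simp add: monic_of_degree_def orthogonal_below_def)
    qed
    have p2: "three_term_poly d0 b0 m = P 0 m" for m
    proof -
      have "monic_of_degree m (three_term_poly d0 b0 m)"
        by (rule three_term_monic[OF three_term_recurrence_poly])
      then show ?thesis
        using multiple_orthogonal_unique[OF P, of "three_term_poly d0 b0 m" 0 m]
          jfraction_orthogonality(1)[OF f2 three_term_recurrence_poly, of m]
        by (simp add: monic_of_degree_def orthogonal_below_def)
    qed
    have "three_term_poly c0 a0 = (\<lambda>n. P n 0)" "three_term_poly d0 b0 = P 0"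
      using p1 p2 by blast+
    then have "three_term_recurrence c0 a0 (\<lambda>n. P n 0)" "three_term_recurrence d0 b0 (P 0)"
      using three_term_recurrence_poly[of c0 a0] three_term_recurrence_poly[of d0 b0] by simp_all
    note u = three_term_coefficients_unique[OF tt(1) this(1)] three_term_coefficients_unique[OF tt(2) this(2)]
    show ?lhs
      by (intro exI[of _ a] exI[of _ b] exI[of _ c] exI[of _ d]) (simp add: sys bdry nz u)
  qed
qed

theorem theorem1p1:
  shows
    "(\<forall>a b c d :: nat \<Rightarrow> nat \<Rightarrow> complex.
        (\<forall>m. a 0 m = 0) \<and> (\<forall>n. b n 0 = 0) \<and>
        (\<forall>n m. n \<ge> 1 \<longrightarrow> a n m \<noteq> 0) \<and> (\<forall>n m. m \<ge> 1 \<longrightarrow> b n m \<noteq> 0) \<longrightarrow>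
        ((\<exists>(\<alpha> :: nat \<Rightarrow> nat \<Rightarrow> nat \<Rightarrow> complex) (\<beta> :: nat \<Rightarrow> nat \<Rightarrow> complex).
            (\<forall>n m x. invertible (L_mat \<alpha> n m x) \<and> invertible (M_mat \<alpha> \<beta> n m x)) \<and>
            (\<forall>n m. c n m = - \<alpha> 1 n m \<and> d n m = - \<beta> n m \<and>
                   a n m = - \<alpha> 4 n m * \<alpha> 2 n m \<and> b n m = - \<alpha> 5 n m * \<alpha> 3 n m) \<and>
            (\<forall>n m x. L_mat \<alpha> n (m + 1) x ** M_mat \<alpha> \<beta> n m x
                   - M_mat \<alpha> \<beta> (n + 1) m x ** L_mat \<alpha> n m x = 0))
         \<longleftrightarrow> difference_system a b c d))
     \<and>
     (\<forall>c0 a0 d0 b0 :: nat \<Rightarrow> complex.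
        (\<exists>a b c d :: nat \<Rightarrow> nat \<Rightarrow> complex.
            difference_system a b c d \<and>
            (\<forall>n. c n 0 = c0 n) \<and> (\<forall>n\<ge>1. a n 0 = a0 n) \<and>
            (\<forall>m. d 0 m = d0 m) \<and> (\<forall>m\<ge>1. b 0 m = b0 m) \<and>
            (\<forall>m. a 0 m = 0) \<and> (\<forall>n. b n 0 = 0) \<and>
            (\<forall>n m. n > 0 \<and> m > 0 \<longrightarrow> a n m \<noteq> 0 \<and> b n m \<noteq> 0))
        \<longleftrightarrow> corresponds_to_perfect_system c0 a0 d0 b0)"
proof (intro conjI allI impI)
  fix a b c d :: "nat \<Rightarrow> nat \<Rightarrow> complex"
  assume "(\<forall>m. a 0 m = 0) \<and> (\<forall>n. b n 0 = 0) \<and>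
        (\<forall>n m. n \<ge> 1 \<longrightarrow> a n m \<noteq> 0) \<and> (\<forall>n m. m \<ge> 1 \<longrightarrow> b n m \<noteq> 0)"
  then show "(\<exists>\<alpha> \<beta>.
            (\<forall>n m x. invertible (L_mat \<alpha> n m x) \<and> invertible (M_mat \<alpha> \<beta> n m x)) \<and>
            (\<forall>n m. c n m = - \<alpha> 1 n m \<and> d n m = - \<beta> n m \<and>
                   a n m = - \<alpha> 4 n m * \<alpha> 2 n m \<and> b n m = - \<alpha> 5 n m * \<alpha> 3 n m) \<and>
            (\<forall>n m x. L_mat \<alpha> n (m + 1) x ** M_mat \<alpha> \<beta> n m x
                   - M_mat \<alpha> \<beta> (n + 1) m x ** L_mat \<alpha> n m x = 0))
         \<longleftrightarrow> difference_system a b c d"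
    by (elim conjE) (rule zero_curvature_iff_difference_system)
qed (rule difference_system_iff_perfect_system)

end
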